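(* Let $\Gamma=\bigcup_{j=1}^s\Gamma_j\subset\mathbb{C}$, where for each $1\le j\le s$ the arc $\Gamma_j=z_j([a_j,b_j])$, $a_j<b_j$, is the image of a map $z_j$ that is either an algebraic polynomial with complex coefficients of degree $k_j\ge1$, or a trigonometric polynomial with complex coefficients of degree $k_j\ge 1$ (with $b_j-a_j\le2\pi$ in the trigonometric case). For $n\ge1$ and $m>1$ let $Z_n^m=\bigcup_{j=1}^s Z_n^m(k_j)$, where $Z_n^m(k_j)\subset\Gamma_j$ is the image under $z_j$ of the mapped Chebyshev points on $[a_j,b_j]$ defined in the context ($m$ being such that all numbers $N_j$ there are integers). Then: (i) for every $n\ge1$, $m>1$ and $p\in\mathbb{P}_n(\mathbb{C})$, $$\|p\|_\Gamma\le c_m\|p\|_{Z_n^m},\qquad c_m=\frac{1}{\cos(\pi/(2m))},$$ so that, for fixed $m$, $(Z_n^m)_{n\ge1}$ is an optimal admissible polynomial mesh for $\Gamma$; (ii) for fixed $m$, $(Z_n^m)_{n\ge 1}$ is also an admissible polynomial mesh for every compact set $K\subset\mathbb{C}$ such that $\partial K_{out}\subseteq\Gamma\subseteq K$, where $\partial K_{out}$ denotes the boundary of the unbounded connected component of $\mathbb{C}\setminus K$.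
   Context: $\mathbb{P}_n(\mathbb{C})$ is the space of polynomials in one complex variable with complex coefficients of degree at most $n$. For a compact set $Y$ (continuous or discrete), $\|\cdot\|_Y$ is the sup-norm on $Y$. A trigonometric polynomial of degree at most $\nu$ with complex coefficients is a complex linear combination of $1,\cos(jt),\sin(jt)$, $1\le j\le\nu$. Chebyshev points: for a positive integer $N$, $\mathcal{T}_N$ denotes either the set of $N$ Chebyshev zeros $\cos((2i-1)\pi/(2N))$, $1\le i\le N$, or the set of $N+1$ Chebyshev extrema $\cos(i\pi/N)$, $0\le i\le N$ (the result holds for either choice). Mapped points: $Z_n^m(k_j)=z_j(\sigma_j(\mathcal{T}_{N_j}))$, where - if $z_j$ is algebraic, $N_j=mnk_j$ and $\sigma_j(u)=\frac{b_j-a_j}{2}u+\frac{b_j+a_j}{2}$, $u\in[-1,1]$; - if $z_j$ is trigonometric, $N_j=2mnk_j$ and $\sigma_j(u)=2\arcsin\left(u\sin\left(\frac{b_j-a_j}{4}\right)\right)+\frac{b_j+a_j}{2}$, $u\in[-1,1]$. Admissible polynomial mesh: let $K\subset\mathbb{C}$ be compact and polynomially determining (a polynomial vanishing on $K$ vanishes identically on $\mathbb{C}$). A sequence of finite subsets $Z_n\subset K$ is an admissible polynomial mesh for $K$ if there is a constant $c$ independent of $n$ with $\|p\|_K\le c\|p\|_{Z_n}$ for all $p\in\mathbb{P}_n(\mathbb{C})$, and $\mathrm{card}(Z_n)=O(n^\alpha)$ for some $\alpha\ge1$. It is optimal if one can take $\alpha=1$. *)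

theory Defs
  imports "HOL-Complex_Analysis.Complex_Analysis" "HOL-Library.Landau_Symbols"
begin

(* The explicit value on the empty set only keeps "Sup {}", which is unspecified on real,
   out of the definition of a mesh below. *)
definition sup_norm :: "complex set \<Rightarrow> (complex \<Rightarrow> complex) \<Rightarrow> real" where
  "sup_norm Y f = (if Y = {} then 0 else (SUP x\<in>Y. norm (f x)))"

definition algebraic_poly_of_degree :: "nat \<Rightarrow> (real \<Rightarrow> complex) \<Rightarrow> bool" where
  "algebraic_poly_of_degree k f \<longleftrightarrow>
     (\<exists>q :: complex poly. degree q = k \<and> f = (\<lambda>t. poly q (complex_of_real t)))"

definition trig_poly_of_degree_le :: "nat \<Rightarrow> (real \<Rightarrow> complex) \<Rightarrow> bool" where
  "trig_poly_of_degree_le \<nu> f \<longleftrightarrow>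
     (\<exists>(c :: complex) (\<alpha> :: nat \<Rightarrow> complex) (\<beta> :: nat \<Rightarrow> complex).
        f = (\<lambda>t. c + (\<Sum>j=1..\<nu>. \<alpha> j * complex_of_real (cos (real j * t))
                            + \<beta> j * complex_of_real (sin (real j * t)))))"

definition trig_poly_of_degree :: "nat \<Rightarrow> (real \<Rightarrow> complex) \<Rightarrow> bool" where
  "trig_poly_of_degree k f \<longleftrightarrow>
     trig_poly_of_degree_le k f \<and> (\<forall>\<nu><k. \<not> trig_poly_of_degree_le \<nu> f)"

definition cheb_zeros :: "nat \<Rightarrow> real set" where
  "cheb_zeros N = (\<lambda>i. cos ((2 * real i - 1) * pi / (2 * real N))) ` {1..N}"

definition cheb_extrema :: "nat \<Rightarrow> real set" where
  "cheb_extrema N = (\<lambda>i. cos (real i * pi / real N)) ` {0..N}"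

datatype map_kind = Algebraic | Trigonometric

(* The number N_j as a real number; it is assumed to be an integer wherever it is used. *)
fun num_nodes :: "map_kind \<Rightarrow> real \<Rightarrow> nat \<Rightarrow> nat \<Rightarrow> real" where
  "num_nodes Algebraic m n k = m * real n * real k"
| "num_nodes Trigonometric m n k = 2 * m * real n * real k"

fun sigma :: "map_kind \<Rightarrow> real \<Rightarrow> real \<Rightarrow> real \<Rightarrow> real" where
  "sigma Algebraic a b u = (b - a) / 2 * u + (b + a) / 2"
| "sigma Trigonometric a b u = 2 * arcsin (u * sin ((b - a) / 4)) + (b + a) / 2"

definition mapped_points ::
    "(nat \<Rightarrow> real set) \<Rightarrow> map_kind \<Rightarrow> (real \<Rightarrow> complex) \<Rightarrow> real \<Rightarrow> real \<Rightarrow> nat \<Rightarrow> real \<Rightarrow> nat \<Rightarrow> complex set" where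
  "mapped_points T knd z a b k m n = z ` sigma knd a b ` T (nat \<lfloor>num_nodes knd m n k\<rfloor>)"

definition polynomially_determining :: "complex set \<Rightarrow> bool" where
  "polynomially_determining K \<longleftrightarrow>
     (\<forall>p :: complex poly. (\<forall>w\<in>K. poly p w = 0) \<longrightarrow> (\<forall>w. poly p w = 0))"

definition polynomial_mesh :: "real \<Rightarrow> complex set \<Rightarrow> (nat \<Rightarrow> complex set) \<Rightarrow> bool" where
  "polynomial_mesh \<alpha> K Z \<longleftrightarrow>
     compact K \<and> polynomially_determining K \<and>
     (\<forall>n\<ge>1. finite (Z n) \<and> Z n \<subseteq> K) \<and>
     (\<exists>c. \<forall>n\<ge>1. \<forall>p :: complex poly. degree p \<le> n \<longrightarrow>
        sup_norm K (poly p) \<le> c * sup_norm (Z n) (poly p)) \<and>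
     (\<lambda>n. real (card (Z n))) \<in> O(\<lambda>n. real n powr \<alpha>)"

definition admissible_mesh :: "complex set \<Rightarrow> (nat \<Rightarrow> complex set) \<Rightarrow> bool" where
  "admissible_mesh K Z \<longleftrightarrow> (\<exists>\<alpha>\<ge>1. polynomial_mesh \<alpha> K Z)"

definition optimal_admissible_mesh :: "complex set \<Rightarrow> (nat \<Rightarrow> complex set) \<Rightarrow> bool" where
  "optimal_admissible_mesh K Z \<longleftrightarrow> polynomial_mesh 1 K Z"

(* For compact K in the complex plane, the library's "outside K" (the union of the unbounded
   components of the complement) is the unique unbounded component of the complement. *)
definition outer_boundary :: "complex set \<Rightarrow> complex set" where
  "outer_boundary K = frontier (outside K)"

end

(* Put u = cos t. On the arc number j, p composed with z_j and sigma_j becomes an even function F of t of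
   "degree" d, where d = n k_j in the algebraic and d = 2 n k_j in the trigonometric case, and N_j = m d.
   If F is real and |F| < 1, then arccos F is d-Lipschitz: a steeper F would meet some cosine
   cos (d (t - beta)) at 2 d + 2 points of a period, but F - cos (d (t - beta)) has at most 2 d zeros there.
   As every t in [0, pi] is within pi / (2 N_j) of a node, the values of arccos F at a maximum point of |F| and
   at a node near it differ by at most pi / (2 m), which gives the constant 1 / cos (pi / (2 m)).

   In the algebraic case F is a trigonometric polynomial of degree d and the bound on the zeros is clear.
   In the trigonometric case, with x = sin ((b - a) / 4) and w(t) = sqrt (1 - x^2 cos^2 t), one has
   F = A + w B with trigonometric polynomials A, B of degrees d and d - 1, where A has period pi and B changes
   sign under t -> t + pi. The cosine above has period pi as well (d is even), so G = F - cos (d (t - beta)) is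
   again of the form A + w B, and G(t) G(t + pi) = A^2 - w^2 B^2 is a trigonometric polynomial of degree 2 d.
   Its at most 4 d zeros are those of G and their shifts by pi, whence G has at most 2 d zeros.

   The mesh property on K follows from that on Gamma by the maximum modulus principle on the complement
   of the unbounded component. *)

theory Submission
  imports Defs
begin

section \<open>Trigonometric polynomials\<close>

text \<open>Trigonometric polynomials of degree at most \<open>d\<close> are encoded by an algebraic polynomial of degree
  at most \<open>2 d\<close> in \<open>cis t\<close>, so that zeros can be counted with the library on polynomial roots.\<close>

definition cis_poly :: "nat \<Rightarrow> (real \<Rightarrow> complex) \<Rightarrow> bool" where
  "cis_poly d f \<longleftrightarrow> (\<exists>q. degree q \<le> 2 * d \<and> (\<forall>t. f t * cis t ^ d = poly q (cis t)))"

lemma poly_eq_sum: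
  fixes q :: "'a::comm_semiring_1 poly"
  assumes "degree q \<le> n"
  shows "poly q x = (\<Sum>i\<le>n. coeff q i * x ^ i)"
  unfolding poly_altdef
  by (intro sum.mono_neutral_left) (use assms in \<open>auto simp: coeff_eq_0\<close>)

lemma cis_polyI:
  assumes "degree q \<le> 2 * d" "\<And>t. f t * cis t ^ d = poly q (cis t)"
  shows "cis_poly d f"
  using assms unfolding cis_poly_def by blast

lemma cis_poly_mono:
  assumes "cis_poly d f" "d \<le> e"
  shows "cis_poly e f"
proof -
  obtain q where q: "degree q \<le> 2 * d" "\<And>t. f t * cis t ^ d = poly q (cis t)"
    using assms(1) unfolding cis_poly_def by blast
  show ?thesis
  proof (rule cis_polyI)
    have "degree (monom 1 (e - d) * q) \<le> (e - d) + degree q"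
      by (metis degree_monom_eq degree_mult_le zero_neq_one)
    with q(1) assms(2) show "degree (monom 1 (e - d) * q) \<le> 2 * e"
      by linarith
    fix t
    have "f t * cis t ^ e = (f t * cis t ^ d) * cis t ^ (e - d)"
      using assms(2) by (simp add: mult.assoc flip: power_add)
    then show "f t * cis t ^ e = poly (monom 1 (e - d) * q) (cis t)"
      by (simp add: q(2) poly_monom)
  qed
qed

lemma cis_poly_mult:
  assumes "cis_poly d f" "cis_poly e g"
  shows "cis_poly (d + e) (\<lambda>t. f t * g t)"
proof -
  obtain q where q: "degree q \<le> 2 * d" "\<And>t. f t * cis t ^ d = poly q (cis t)"
    using assms(1) unfolding cis_poly_def by blast
  obtain r where r: "degree r \<le> 2 * e" "\<And>t. g t * cis t ^ e = poly r (cis t)"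
    using assms(2) unfolding cis_poly_def by blast
  show ?thesis
  proof (rule cis_polyI)
    show "degree (q * r) \<le> 2 * (d + e)"
      by (rule order_trans[OF degree_mult_le]) (use q(1) r(1) in simp)
    show "f t * g t * cis t ^ (d + e) = poly (q * r) (cis t)" for t
      by (simp add: power_add flip: q(2) r(2))
  qed
qed

lemma cis_poly_add:
  assumes "cis_poly d f" "cis_poly d g"
  shows "cis_poly d (\<lambda>t. f t + g t)"
proof -
  obtain q where q: "degree q \<le> 2 * d" "\<And>t. f t * cis t ^ d = poly q (cis t)"
    using assms(1) unfolding cis_poly_def by blast
  obtain r where r: "degree r \<le> 2 * d" "\<And>t. g t * cis t ^ d = poly r (cis t)"
    using assms(2) unfolding cis_poly_def by blast
  show ?thesis
    by (rule cis_polyI[of "q + r"]) (simp_all add: degree_add_le q(1) r(1) distrib_right flip: q(2) r(2))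
qed

lemma cis_poly_const: "cis_poly d (\<lambda>_. c)"
  by (rule cis_poly_mono[of 0]) (auto intro: cis_polyI[of "[:c:]"])

lemma cis_poly_cmult: "cis_poly d f \<Longrightarrow> cis_poly d (\<lambda>t. c * f t)"
  using cis_poly_mult[OF cis_poly_const[of 0 c]] by simp

lemma cis_poly_diff:
  assumes "cis_poly d f" "cis_poly d g"
  shows "cis_poly d (\<lambda>t. f t - g t)"
  using cis_poly_add[OF assms(1) cis_poly_cmult[OF assms(2), of "-1"]] by simp

lemma cis_poly_sum:
  assumes "\<And>i. i \<in> I \<Longrightarrow> cis_poly d (f i)"
  shows "cis_poly d (\<lambda>t. \<Sum>i\<in>I. f i t)"
  using assms
  by (induction I rule: infinite_finite_induct) (auto intro: cis_poly_const cis_poly_add)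

lemma cis_poly_power: "cis_poly d f \<Longrightarrow> cis_poly (n * d) (\<lambda>t. f t ^ n)"
proof (induction n)
  case 0
  then show ?case by (simp add: cis_poly_const)
next
  case (Suc n)
  then show ?case using cis_poly_mult[of d f "n * d" "\<lambda>t. f t ^ n"] by simp
qed

text \<open>On the unit circle conjugation is inversion. Multiplying
  \<open>cnj (poly q (cis t))\<close> by \<open>cis t ^ (2 * d)\<close> therefore gives the
  polynomial whose coefficients are those of \<open>q\<close>, conjugated and in reverse order. This
  yields closure under real parts.\<close>

lemma cis_poly_cnj:
  assumes "cis_poly d f"
  shows "cis_poly d (\<lambda>t. cnj (f t))"
proof -
  obtain q where q: "degree q \<le> 2 * d" "\<And>t. f t * cis t ^ d = poly q (cis t)"
    using assms(1) unfolding cis_poly_def by blast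
  show ?thesis
  proof (rule cis_polyI)
    show "degree (\<Sum>i\<le>2*d. monom (cnj (coeff q i)) (2 * d - i)) \<le> 2 * d"
      by (intro degree_sum_le) (auto intro: order_trans[OF degree_monom_le])
    fix t
    have "cnj (cis t) * cis t = 1"
      by (simp add: cis_cnj cis_mult)
    then have unit: "cnj (cis t) ^ i * cis t ^ i = 1" for i
      by (simp flip: power_mult_distrib)
    have "cnj (f t) * cis t ^ d = cnj (f t) * (cnj (cis t) ^ d * cis t ^ d) * cis t ^ d"
      by (simp only: unit mult_1_right)
    also have "\<dots> = cnj (f t * cis t ^ d) * cis t ^ (2 * d)"
      by (simp add: mult_2 power_add)
    also have "f t * cis t ^ d = (\<Sum>i\<le>2*d. coeff q i * cis t ^ i)"
      unfolding q(2) using poly_eq_sum[OF q(1)] by blast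
    also have "cnj \<dots> * cis t ^ (2 * d) = (\<Sum>i\<le>2*d. cnj (coeff q i) * (cnj (cis t) ^ i * cis t ^ (2 * d)))"
      by (simp add: sum_distrib_right mult.assoc)
    also have "\<dots> = (\<Sum>i\<le>2*d. cnj (coeff q i) * cis t ^ (2 * d - i))"
    proof (intro sum.cong refl arg_cong2[where f = "(*)"])
      fix i assume "i \<in> {..2*d}"
      then have "cis t ^ (2 * d) = cis t ^ i * cis t ^ (2 * d - i)"
        by (simp flip: power_add)
      then show "cnj (cis t) ^ i * cis t ^ (2 * d) = cis t ^ (2 * d - i)"
        by (metis mult.assoc mult_1_left unit)
    qed
    finally show "cnj (f t) * cis t ^ d = poly (\<Sum>i\<le>2*d. monom (cnj (coeff q i)) (2 * d - i)) (cis t)"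
      by (simp add: poly_sum poly_monom)
  qed
qed

lemma cis_poly_Re:
  assumes "cis_poly d f"
  shows "cis_poly d (\<lambda>t. of_real (Re (f t)))"
proof -
  have "complex_of_real (Re w) = (1 / 2) * (w + cnj w)" for w
    by (simp add: complex_add_cnj)
  then show ?thesis
    using cis_poly_cmult[OF cis_poly_add[OF assms cis_poly_cnj[OF assms]], of "1 / 2"] by presburger
qed

lemma cis_poly_cis: "cis_poly 1 cis"
  by (rule cis_polyI[of "[:0, 0, 1:]"]) (simp_all)

lemma cis_poly_cis_power: "cis_poly n (\<lambda>t. cis t ^ n)"
  using cis_poly_power[OF cis_poly_cis, of n] by simp

lemma cis_poly_cos_shift: "cis_poly d (\<lambda>t. of_real (cos (real d * (t - \<beta>))))"
proof -
  have "cos (real d * (t - \<beta>)) = Re (cis (- real d * \<beta>) * cis t ^ d)" for t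
    by (simp only: Complex.DeMoivre cis_mult cis.sel) (simp add: algebra_simps)
  then show ?thesis
    using cis_poly_Re[OF cis_poly_cmult[OF cis_poly_cis_power]] by presburger
qed

lemma cis_poly_cos: "cis_poly 1 (\<lambda>t. of_real (cos t))"
  using cis_poly_cos_shift[of 1 0] by simp

lemma cis_poly_poly_cos:
  assumes "degree q \<le> n"
  shows "cis_poly n (\<lambda>t. poly q (of_real (cos t)))"
proof -
  have "cis_poly n (\<lambda>t. \<Sum>i\<le>n. coeff q i * of_real (cos t) ^ i)"
    by (intro cis_poly_sum cis_poly_cmult cis_poly_mono[OF cis_poly_power[OF cis_poly_cos]]) simp
  then show ?thesis
    using poly_eq_sum[OF assms] by presburger
qed

section \<open>Zeros of trigonometric polynomials as roots on the unit circle\<close>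

lemma sum_order_le_degree:
  fixes q :: "'a::idom poly"
  assumes "q \<noteq> 0" "finite S"
  shows "(\<Sum>x\<in>S. order x q) \<le> degree q"
proof -
  have "(\<Sum>x\<in>S. order x q) = (\<Sum>x\<in>S. count (proots q) x)"
    using assms(1) by simp
  also have "\<dots> \<le> size (proots q)"
  proof -
    have "(\<Sum>x\<in>S. count (proots q) x) = (\<Sum>x\<in>S \<inter> set_mset (proots q). count (proots q) x)"
      using assms(2) by (intro sum.mono_neutral_right) (auto simp: not_in_iff)
    also have "\<dots> \<le> (\<Sum>x\<in>set_mset (proots q). count (proots q) x)"
      by (intro sum_mono2) auto
    finally show ?thesis
      by (simp add: size_multiset_overloaded_eq)
  qed
  also have "\<dots> \<le> degree q"
    by (rule size_proots_le)
  finally show ?thesis .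
qed

text \<open>In characteristic zero, differentiation lowers the order of a root by exactly
  one.\<close>

lemma order_ge_2I:
  fixes q :: "'a::field_char_0 poly"
  assumes "q \<noteq> 0" "poly q x = 0" "poly (pderiv q) x = 0"
  shows "order x q \<ge> 2"
proof -
  have "order x q \<noteq> 0"
    using assms by (simp add: order_root)
  moreover have "order x q = Suc (order x (pderiv q))"
    by (meson assms calculation order_pderiv)
  moreover have "pderiv q \<noteq> 0"
    using assms(1,2) pderiv_iszero by fastforce
  then have "order x (pderiv q) \<noteq> 0"
    using assms(3) by (simp add: order_root)
  ultimately show ?thesis by linarith
qed

lemma cis_inj_on: "inj_on cis {\<beta>..<\<beta> + 2 * pi}"
proof (rule inj_onI)
  fix x y assume *: "x \<in> {\<beta>..<\<beta> + 2 * pi}" "y \<in> {\<beta>..<\<beta> + 2 * pi}" "cis x = cis y"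
  then have "cis (x - y) = 1"
    by (simp flip: cis_divide)
  then have "cos (x - y) = 1"
    by (metis cis.sel(1) one_complex.sel(1))
  then obtain n :: int where n: "x - y = of_int n * 2 * pi"
    using cos_one_2pi_int[of "x - y"] by (auto simp: mult_ac)
  have "\<bar>x - y\<bar> < 2 * pi"
    using *(1,2) by auto
  with n have "\<bar>of_int n\<bar> < (1::real)"
    by (auto simp: abs_mult)
  then have "n = 0"
    by linarith
  with n show "x = y"
    by simp
qed

text \<open>Since \<open>cis\<close> is injective on a half-open period, distinct zeros of
  \<open>f\<close> give distinct roots of the encoding polynomial. The point \<open>t0\<close>
  guarantees that this polynomial is not 0.\<close>

lemma cis_poly_card_zeros:
  assumes "cis_poly d f" "f t0 \<noteq> 0" "finite S" "S \<subseteq> {\<beta>..<\<beta> + 2 * pi}" "\<And>t. t \<in> S \<Longrightarrow> f t = 0"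
  shows "card S \<le> 2 * d"
proof -
  obtain q where q: "degree q \<le> 2 * d" "\<And>t. f t * cis t ^ d = poly q (cis t)"
    using assms(1) unfolding cis_poly_def by blast
  have "q \<noteq> 0"
    using q(2)[of t0] assms(2) by auto
  have "card S = card (cis ` S)"
    using card_image[OF inj_on_subset[OF cis_inj_on assms(4)]] by simp
  also have "\<dots> \<le> card {x. poly q x = 0}"
    using \<open>q \<noteq> 0\<close> assms(5) q(2) by (intro card_mono poly_roots_finite) (force simp flip: q(2))+
  also have "\<dots> \<le> degree q"
    by (rule card_poly_roots_bound[OF \<open>q \<noteq> 0\<close>])
  finally show ?thesis using q(1) by linarith
qed

text \<open>As \<open>exp (\<i> * u)\<close> has no zeros, the encoding exhibits \<open>f\<close> as
  the restriction of an entire function to the real line. The derivatives serve to detect double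
  roots below.\<close>

lemma cis_poly_differentiable:
  assumes "cis_poly d f"
  shows "\<exists>f'. (f has_vector_derivative f') (at t)"
proof -
  obtain q where q: "degree q \<le> 2 * d" "\<And>t. f t * cis t ^ d = poly q (cis t)"
    using assms(1) unfolding cis_poly_def by blast
  have f: "f = (\<lambda>t. ((\<lambda>u. poly q (exp (\<i> * u)) / exp (\<i> * u) ^ d) \<circ> of_real) t)"
  proof
    fix t
    show "f t = ((\<lambda>u. poly q (exp (\<i> * u)) / exp (\<i> * u) ^ d) \<circ> of_real) t"
      using q(2)[of t] by (simp add: cis_conv_exp field_simps)
  qed
  have "(\<lambda>u. poly q (exp (\<i> * u)) / exp (\<i> * u) ^ d) holomorphic_on UNIV"
    by (intro holomorphic_intros) auto
  then obtain D where "((\<lambda>u. poly q (exp (\<i> * u)) / exp (\<i> * u) ^ d) has_field_derivative D) (at (of_real t))"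
    by (metis UNIV_I holomorphic_derivI open_UNIV)
  then show ?thesis
    unfolding f comp_def using has_vector_derivative_real_field by blast
qed

section \<open>Trigonometric polynomials with a radical\<close>

text \<open>For \<open>d = 0\<close> the condition on \<open>B\<close> forces \<open>B = 0\<close>: then \<open>B\<close> is constant and antiperiodic.\<close>

definition radical_poly :: "real \<Rightarrow> nat \<Rightarrow> (real \<Rightarrow> complex) \<Rightarrow> bool" where
  "radical_poly x d f \<longleftrightarrow>
     (\<exists>A B. cis_poly d A \<and> cis_poly (d - 1) B \<and> (\<forall>t. A (t + pi) = A t) \<and> (\<forall>t. B (t + pi) = - B t) \<and>
        (\<forall>t. f t = A t + of_real (sqrt (1 - (x * cos t)\<^sup>2)) * B t))"

lemma radical_polyI:
  assumes "cis_poly d A" "cis_poly (d - 1) B" "\<And>t. A (t + pi) = A t" "\<And>t. B (t + pi) = - B t"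
    "\<And>t. f t = A t + of_real (sqrt (1 - (x * cos t)\<^sup>2)) * B t"
  shows "radical_poly x d f"
  unfolding radical_poly_def using assms by blast

lemma radical_polyE:
  assumes "radical_poly x d f"
  obtains A B where "cis_poly d A" "cis_poly (d - 1) B" "\<And>t. A (t + pi) = A t" "\<And>t. B (t + pi) = - B t"
    "\<And>t. f t = A t + of_real (sqrt (1 - (x * cos t)\<^sup>2)) * B t"
  using assms unfolding radical_poly_def by blast

lemma radical_poly_mono:
  assumes "radical_poly x d f" "d \<le> e"
  shows "radical_poly x e f"
  using assms(1)
proof (rule radical_polyE)
  fix A B
  assume *: "cis_poly d A" "cis_poly (d - 1) B" "\<And>t. A (t + pi) = A t" "\<And>t. B (t + pi) = - B t"
    "\<And>t. f t = A t + of_real (sqrt (1 - (x * cos t)\<^sup>2)) * B t"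
  show ?thesis
    using assms(2) by (intro radical_polyI[of e A B] cis_poly_mono[OF *(1)] cis_poly_mono[OF *(2)] *) auto
qed

lemma radical_poly_of_periodic:
  assumes "cis_poly d f" "\<And>t. f (t + pi) = f t"
  shows "radical_poly x d f"
  by (rule radical_polyI[of d f "\<lambda>_. 0"]) (auto intro: assms cis_poly_const)

lemma radical_poly_const: "radical_poly x d (\<lambda>_. c)"
  by (intro radical_poly_of_periodic cis_poly_const refl)

lemma radical_poly_add:
  assumes "radical_poly x d f" "radical_poly x d g"
  shows "radical_poly x d (\<lambda>t. f t + g t)"
proof -
  obtain A B where f: "cis_poly d A" "cis_poly (d - 1) B" "\<And>t. A (t + pi) = A t" "\<And>t. B (t + pi) = - B t"
    "\<And>t. f t = A t + of_real (sqrt (1 - (x * cos t)\<^sup>2)) * B t"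
    using assms(1) by (rule radical_polyE) blast
  obtain C D where g: "cis_poly d C" "cis_poly (d - 1) D" "\<And>t. C (t + pi) = C t" "\<And>t. D (t + pi) = - D t"
    "\<And>t. g t = C t + of_real (sqrt (1 - (x * cos t)\<^sup>2)) * D t"
    using assms(2) by (rule radical_polyE) blast
  show ?thesis
    by (rule radical_polyI[of d "\<lambda>t. A t + C t" "\<lambda>t. B t + D t"])
      (simp_all add: f g cis_poly_add algebra_simps del: One_nat_def)
qed

lemma radical_poly_cmult:
  assumes "radical_poly x d f"
  shows "radical_poly x d (\<lambda>t. c * f t)"
proof -
  obtain A B where f: "cis_poly d A" "cis_poly (d - 1) B" "\<And>t. A (t + pi) = A t" "\<And>t. B (t + pi) = - B t"
    "\<And>t. f t = A t + of_real (sqrt (1 - (x * cos t)\<^sup>2)) * B t"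
    using assms(1) by (rule radical_polyE) blast
  show ?thesis
    by (rule radical_polyI[of d "\<lambda>t. c * A t" "\<lambda>t. c * B t"])
      (simp_all add: f cis_poly_cmult algebra_simps del: One_nat_def)
qed

lemma radical_poly_sum:
  assumes "\<And>i. i \<in> I \<Longrightarrow> radical_poly x d (f i)"
  shows "radical_poly x d (\<lambda>t. \<Sum>i\<in>I. f i t)"
  using assms
  by (induction I rule: infinite_finite_induct) (auto intro: radical_poly_const radical_poly_add)

lemma radical_poly_cnj:
  assumes "radical_poly x d f"
  shows "radical_poly x d (\<lambda>t. cnj (f t))"
proof -
  obtain A B where f: "cis_poly d A" "cis_poly (d - 1) B" "\<And>t. A (t + pi) = A t" "\<And>t. B (t + pi) = - B t"
    "\<And>t. f t = A t + of_real (sqrt (1 - (x * cos t)\<^sup>2)) * B t"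
    using assms(1) by (rule radical_polyE) blast
  show ?thesis
    by (rule radical_polyI[of d "\<lambda>t. cnj (A t)" "\<lambda>t. cnj (B t)"]) (simp_all add: f cis_poly_cnj del: One_nat_def)
qed

lemma radical_poly_Re:
  assumes "radical_poly x d f"
  shows "radical_poly x d (\<lambda>t. of_real (Re (f t)))"
proof -
  have "complex_of_real (Re w) = (1 / 2) * (w + cnj w)" for w
    by (simp add: complex_add_cnj)
  then show ?thesis
    using radical_poly_cmult[OF radical_poly_add[OF assms radical_poly_cnj[OF assms]], of "1 / 2"]
    by presburger
qed

lemma cis_poly_radicand: "cis_poly 2 (\<lambda>t. of_real (1 - (x * cos t)\<^sup>2))"
proof -
  have "cis_poly 2 (\<lambda>t. 1 - of_real (x\<^sup>2) * of_real (cos t) ^ 2)"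
    by (intro cis_poly_diff cis_poly_const cis_poly_cmult cis_poly_mono[OF cis_poly_power[OF cis_poly_cos]]) simp
  then show ?thesis
    by (simp add: power_mult_distrib)
qed

lemma radicand_nonneg:
  fixes x :: real
  assumes "\<bar>x\<bar> \<le> 1"
  shows "(x * cos t)\<^sup>2 \<le> 1"
  using mult_mono[OF assms abs_cos_le_one[of t]] by (simp add: abs_square_le_1 abs_mult)

text \<open>Write \<open>w\<close> for the radical. In \<open>(A + w B) (C + w D)\<close> the square
  of \<open>w\<close> is a trigonometric polynomial of degree 2, so \<open>w^2 B D\<close> has
  degree (d - 1) + (e - 1) + 2 = d + e. This balance explains the degree \<open>d - 1\<close> of the
  coefficient of the radical. Positive \<open>d\<close> and \<open>e\<close> keep the truncated
  subtractions exact.\<close>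

lemma radical_poly_mult:
  assumes "\<bar>x\<bar> \<le> 1" "d \<ge> 1" "e \<ge> 1" "radical_poly x d f" "radical_poly x e g"
  shows "radical_poly x (d + e) (\<lambda>t. f t * g t)"
proof -
  obtain A B where f: "cis_poly d A" "cis_poly (d - 1) B" "\<And>t. A (t + pi) = A t" "\<And>t. B (t + pi) = - B t"
    "\<And>t. f t = A t + of_real (sqrt (1 - (x * cos t)\<^sup>2)) * B t"
    using assms(4) by (rule radical_polyE) blast
  obtain C D where g: "cis_poly e C" "cis_poly (e - 1) D" "\<And>t. C (t + pi) = C t" "\<And>t. D (t + pi) = - D t"
    "\<And>t. g t = C t + of_real (sqrt (1 - (x * cos t)\<^sup>2)) * D t"
    using assms(5) by (rule radical_polyE) blast
  have deg: "2 + ((d - 1) + (e - 1)) = d + e" "d + (e - 1) = d + e - 1" "d - 1 + e = d + e - 1"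
    using assms(2,3) by auto
  show ?thesis
  proof (rule radical_polyI)
    show "cis_poly (d + e) (\<lambda>t. A t * C t + of_real (1 - (x * cos t)\<^sup>2) * (B t * D t))"
      using cis_poly_mult[OF f(1) g(1)] cis_poly_mult[OF cis_poly_radicand cis_poly_mult[OF f(2) g(2)]]
      unfolding deg by (rule cis_poly_add)
    show "cis_poly (d + e - 1) (\<lambda>t. A t * D t + B t * C t)"
      using cis_poly_mult[OF f(1) g(2)] cis_poly_mult[OF f(2) g(1)] unfolding deg
      by (rule cis_poly_add)
    fix t
    define w where "w = complex_of_real (sqrt (1 - (x * cos t)\<^sup>2))"
    have w: "of_real (1 - (x * cos t)\<^sup>2) = w * w"
      using radicand_nonneg[OF assms(1), of t] unfolding w_def by (simp flip: of_real_mult)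
    show "f t * g t = A t * C t + of_real (1 - (x * cos t)\<^sup>2) * (B t * D t)
        + of_real (sqrt (1 - (x * cos t)\<^sup>2)) * (A t * D t + B t * C t)"
      unfolding f(5)[of t] g(5)[of t] w w_def[symmetric] by (simp add: algebra_simps)
  qed (simp_all add: f g)
qed

lemma radical_poly_power:
  assumes "\<bar>x\<bar> \<le> 1" "d \<ge> 1" "radical_poly x d f" "n * d \<le> e"
  shows "radical_poly x e (\<lambda>t. f t ^ n)"
proof (cases "n = 0")
  case False
  then have "n \<ge> 1" by simp
  \<comment> \<open>The product rule demands positive degrees, so the induction starts at
    \<open>n = 1\<close>.\<close>
  then have "radical_poly x (n * d) (\<lambda>t. f t ^ n)"
  proof (induction n rule: dec_induct)
    case (step n)
    show ?case
      using radical_poly_mult[OF assms(1,2) _ assms(3) step.IH] step.hyps assms(2) by simp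
  qed (use assms in simp)
  then show ?thesis
    using assms(4) by (rule radical_poly_mono)
qed (simp add: radical_poly_const)

text \<open>With \<open>y = x * cos t\<close> this is the square of sqrt (1 - y^2) + i y, namely 1 -
  2 y^2 + 2 i y sqrt (1 - y^2). The part without the radical has period pi, and \<open>cos t\<close>
  in the other part changes sign under the shift by pi.\<close>

lemma radical_poly_cis_arcsin:
  assumes "\<bar>x\<bar> \<le> 1"
  shows "radical_poly x 2 (\<lambda>t. cis (2 * arcsin (x * cos t)))"
proof (rule radical_polyI)
  show "cis_poly 2 (\<lambda>t. 1 - of_real (2 * x\<^sup>2) * of_real (cos t) ^ 2)"
    by (intro cis_poly_diff cis_poly_const cis_poly_cmult cis_poly_mono[OF cis_poly_power[OF cis_poly_cos]]) simp
  show "cis_poly (2 - 1) (\<lambda>t. 2 * \<i> * x * of_real (cos t))"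
    using cis_poly_cos by (intro cis_poly_cmult) simp
  fix t
  define y where "y = x * cos t"
  have y: "y\<^sup>2 \<le> 1"
    unfolding y_def using radicand_nonneg[OF assms] .
  have "cis (2 * arcsin y) = cis (arcsin y) * cis (arcsin y)"
    by (simp add: cis_mult)
  also have "cis (arcsin y) = Complex (sqrt (1 - y\<^sup>2)) y"
    using y by (simp add: complex_eq_iff cos_arcsin abs_square_le_1 sin_arcsin abs_le_iff)
  also have "Complex (sqrt (1 - y\<^sup>2)) y * Complex (sqrt (1 - y\<^sup>2)) y = Complex (1 - 2 * y\<^sup>2) (2 * sqrt (1 - y\<^sup>2) * y)"
    using y by (simp add: complex_eq_iff power2_eq_square)
  finally show "cis (2 * arcsin (x * cos t)) = 1 - of_real (2 * x\<^sup>2) * of_real (cos t) ^ 2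
     + of_real (sqrt (1 - (x * cos t)\<^sup>2)) * (2 * \<i> * x * of_real (cos t))"
    unfolding y_def by (simp add: complex_eq_iff power2_eq_square)
qed simp_all

section \<open>Zeros of expressions with a radical\<close>

lemma cis_poly_cong:
  assumes "cis_poly d f" "cis s = cis t"
  shows "f s = f t"
  using assms unfolding cis_poly_def by (metis cis_neq_zero mult_right_cancel power_not_zero)

lemma radical_poly_cong:
  assumes "radical_poly x d f" "cis s = cis t"
  shows "f s = f t"
proof -
  obtain A B where f: "cis_poly d A" "cis_poly (d - 1) B"
    "\<And>t. f t = A t + of_real (sqrt (1 - (x * cos t)\<^sup>2)) * B t"
    using assms(1) by (rule radical_polyE) blast
  have "cos s = cos t"
    using assms(2) by (metis cis.sel(1))
  then show ?thesis
    unfolding f(3) using cis_poly_cong[OF f(1) assms(2)] cis_poly_cong[OF f(2) assms(2)] by simp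
qed

lemma has_vector_derivative_cis: "(cis has_vector_derivative \<i> * cis t) (at t)"
  unfolding has_vector_derivative_complex_iff by (auto intro!: derivative_eq_intros)

text \<open>A zero \<open>t\<close> of \<open>f\<close> makes both \<open>cis t\<close> and
  \<open>- cis t\<close> roots of the polynomial \<open>q\<close> that encodes f(t) f(t + pi). These
  roots can coincide for different zeros, namely if \<open>f\<close> vanishes at both
  \<open>t\<close> and \<open>t + pi\<close>, so roots are counted with multiplicity: twice
  \<open>card S\<close> is at most the degree 4 d. The point \<open>t0\<close> guarantees that
  \<open>q\<close> is not 0.\<close>

lemma radical_poly_card_zeros:
  assumes "\<bar>x\<bar> \<le> 1" "d \<ge> 1" "radical_poly x d f" "f t0 * f (t0 + pi) \<noteq> 0"
    and S: "finite S" "S \<subseteq> {\<beta>..<\<beta> + 2 * pi}" "\<And>t. t \<in> S \<Longrightarrow> f t = 0"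
  shows "card S \<le> 2 * d"
proof -
  obtain A B where f: "cis_poly d A" "cis_poly (d - 1) B" "\<And>t. A (t + pi) = A t" "\<And>t. B (t + pi) = - B t"
    "\<And>t. f t = A t + of_real (sqrt (1 - (x * cos t)\<^sup>2)) * B t"
    using assms(3) by (rule radical_polyE) blast
  define w where "w t = complex_of_real (sqrt (1 - (x * cos t)\<^sup>2))" for t
  define W where "W t = complex_of_real (1 - (x * cos t)\<^sup>2)" for t
  define P where "P t = A t * A t - W t * (B t * B t)" for t
  have W: "W t = w t * w t" for t
    using radicand_nonneg[OF assms(1), of t] unfolding w_def W_def by (simp flip: of_real_mult)
  have f_shift: "f (t + pi) = A t - w t * B t" for t
    unfolding f(5) by (simp add: f w_def)
  have P: "P t = f t * f (t + pi)" for t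
    unfolding P_def f_shift W f(5)[of t] w_def[symmetric] by (simp add: algebra_simps)
  have "2 + ((d - 1) + (d - 1)) = 2 * d" "d + d = 2 * d"
    using assms(2) by auto
  then have "cis_poly (2 * d) P"
    using cis_poly_mult[OF cis_poly_radicand[of x] cis_poly_mult[OF f(2) f(2)]] cis_poly_mult[OF f(1) f(1)]
    unfolding P_def W_def by (metis cis_poly_diff)
  then obtain q where q: "degree q \<le> 4 * d" "\<And>t. P t * cis t ^ (2 * d) = poly q (cis t)"
    unfolding cis_poly_def by auto
  have "q \<noteq> 0"
    using q(2)[of t0] assms(4) P by auto
  have root: "poly q (cis t) = 0" if "f t = 0 \<or> f (t + pi) = 0" for t
    using that q(2)[of t] P by auto
  \<comment> \<open>The radical \<open>w\<close> may fail to be differentiable where the radicand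
    \<open>W\<close> vanishes, so the product rule is applied to \<open>P\<close> in the form A^2 -
    W B^2 and not to \<open>f\<close>.\<close>
  have double_root: "poly (pderiv q) (cis t) = 0" if "f t = 0" "f (t + pi) = 0" for t
  proof -
    have zeros: "A t = 0" "w t * B t = 0"
      using that unfolding f_shift f(5)[of t] w_def[symmetric] by (auto simp: eq_neg_iff_add_eq_0)
    obtain A' where A': "(A has_vector_derivative A') (at t)"
      using cis_poly_differentiable[OF f(1)] by blast
    obtain B' where B': "(B has_vector_derivative B') (at t)"
      using cis_poly_differentiable[OF f(2)] by blast
    define W' where "W' = complex_of_real (2 * x\<^sup>2 * cos t * sin t)"
    have W': "(W has_vector_derivative W') (at t)"
      unfolding W_def W'_def has_vector_derivative_complex_iff
      by (auto intro!: derivative_eq_intros simp: power2_eq_square)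
    \<comment> \<open>If \<open>B t\<close> is not 0, then \<open>W t = 0\<close>, that is, x^2
      cos^2 t = 1. With |x| <= 1 this forces \<open>sin t = 0\<close>, and hence
      \<open>W' = 0\<close>.\<close>
    have "W' * (B t * B t) = 0"
    proof (cases "B t = 0")
      case False
      then have "W t = 0"
        using zeros W by simp
      then have sq: "x\<^sup>2 * (cos t)\<^sup>2 = 1"
        unfolding W_def of_real_eq_0_iff by (simp add: power_mult_distrib)
      have "(cos t)\<^sup>2 = 1"
      proof (rule antisym)
        show "(cos t)\<^sup>2 \<le> 1"
          by (simp add: abs_square_le_1)
        have "x\<^sup>2 * (cos t)\<^sup>2 \<le> 1 * (cos t)\<^sup>2"
          using assms(1) by (intro mult_right_mono) (auto simp: abs_square_le_1)
        with sq show "1 \<le> (cos t)\<^sup>2" by simp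
      qed
      then have "sin t = 0"
        using sin_cos_squared_add[of t] by simp
      then show ?thesis
        unfolding W'_def by simp
    qed simp
    moreover have "W t * B t = 0"
      using zeros W by simp
    ultimately have zero: "A t * A' + A' * A t - (W t * (B t * B' + B' * B t) + W' * (B t * B t)) = 0"
      using zeros by (auto simp: algebra_simps)
    have "(P has_vector_derivative
        A t * A' + A' * A t - (W t * (B t * B' + B' * B t) + W' * (B t * B t))) (at t)"
      unfolding P_def
      by (intro has_vector_derivative_diff has_vector_derivative_mult A' B' W')
    then have P': "(P has_vector_derivative 0) (at t)"
      unfolding zero .
    have "((\<lambda>u. u ^ (2 * d)) \<circ> cis has_vector_derivative
       (\<i> * cis t) * (of_nat (2 * d) * cis t ^ (2 * d - 1))) (at t)"
      by (rule field_vector_diff_chain_at[OF has_vector_derivative_cis])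
        (auto intro!: derivative_eq_intros)
    from has_vector_derivative_mult[OF P' this]
    have "((\<lambda>t. P t * cis t ^ (2 * d)) has_vector_derivative 0) (at t)"
      using P that by simp
    moreover have "(poly q \<circ> cis has_vector_derivative (\<i> * cis t) * poly (pderiv q) (cis t)) (at t)"
      by (rule field_vector_diff_chain_at[OF has_vector_derivative_cis]) (rule poly_DERIV)
    then have "((\<lambda>t. P t * cis t ^ (2 * d)) has_vector_derivative (\<i> * cis t) * poly (pderiv q) (cis t)) (at t)"
      unfolding q(2) comp_def .
    ultimately have "(\<i> * cis t) * poly (pderiv q) (cis t) = 0"
      by (metis vector_derivative_unique_at)
    then show ?thesis
      by simp
  qed
  \<comment> \<open>A zero common to \<open>f\<close> and its shift lies in both \<open>E\<close> and \<open>-E\<close>, but is a double root of \<open>q\<close>.\<close>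
  define E where "E = cis ` S"
  have E: "finite E" "card E = card S"
    using S(1) card_image[OF inj_on_subset[OF cis_inj_on S(2)]] unfolding E_def by auto
  have "2 * card S = card E + card (uminus ` E)"
    using E by (simp add: card_image)
  also have "\<dots> = card (E \<union> uminus ` E) + card (E \<inter> uminus ` E)"
    using E(1) by (intro card_Un_Int) auto
  also have "\<dots> = (\<Sum>e\<in>E \<union> uminus ` E. 1 + (if e \<in> E \<inter> uminus ` E then 1 else 0))"
    using E(1) by (subst sum.distrib, subst sum.inter_restrict[symmetric]) (auto intro!: arg_cong[where f = card])
  also have "\<dots> \<le> (\<Sum>e\<in>E \<union> uminus ` E. order e q)"
  proof (rule sum_mono)
    fix e assume e: "e \<in> E \<union> uminus ` E"
    have shift: "cis (t + pi) = - cis t" for t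
      by (simp flip: cis_mult)
    have "poly q e = 0"
    proof (cases "e \<in> E")
      case True
      then show ?thesis
        using S(3) root unfolding E_def by blast
    next
      case False
      then obtain t where t: "t \<in> S" "e = - cis t"
        using e unfolding E_def by auto
      have "f (t + pi + pi) = f t"
        by (rule radical_poly_cong[OF assms(3)]) (simp only: shift minus_minus)
      then show ?thesis
        using root[of "t + pi"] S(3)[OF t(1)] t(2) shift by metis
    qed
    show "1 + (if e \<in> E \<inter> uminus ` E then 1 else 0) \<le> order e q"
    proof (cases "e \<in> E \<inter> uminus ` E")
      case True
      then obtain t s where *: "t \<in> S" "e = cis t" "s \<in> S" "e = - cis s"
        unfolding E_def by blast
      then have "f (t + pi) = f s"
        by (intro radical_poly_cong[OF assms(3)]) (metis shift minus_minus)
      then have "poly (pderiv q) e = 0"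
        using double_root[of t] S(3) * by simp
      then have "order e q \<ge> 2"
        using order_ge_2I[OF \<open>q \<noteq> 0\<close> \<open>poly q e = 0\<close>] by blast
      then show ?thesis
        by simp
    next
      case False
      have "order e q \<noteq> 0"
        using \<open>q \<noteq> 0\<close> \<open>poly q e = 0\<close> by (simp add: order_root)
      then show ?thesis
        unfolding if_not_P[OF False] by simp
    qed
  qed
  also have "\<dots> \<le> degree q"
    using E(1) \<open>q \<noteq> 0\<close> by (intro sum_order_le_degree) auto
  finally show ?thesis
    using q(1) by linarith
qed

section \<open>Norming by Chebyshev points\<close>

text \<open>The intermediate value theorem gives a zero in each gap. The strict signs at the points
  \<open>p i\<close> keep it off the ends of the gap, so the \<open>m\<close> zeros are
  distinct.\<close>

lemma alternating_signs_zeros: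
  fixes g :: "real \<Rightarrow> real"
  assumes "continuous_on UNIV g" "\<And>i. i < m \<Longrightarrow> p i < p (Suc i)"
    and sgn: "\<And>i. i \<le> m \<Longrightarrow> (- 1) ^ i * g (p i) > 0"
  obtains S where "finite S" "card S = m" "S \<subseteq> {p 0<..<p m}" "\<And>t. t \<in> S \<Longrightarrow> g t = 0"
proof -
  have "\<exists>c. p i < c \<and> c < p (Suc i) \<and> g c = 0" if i: "i < m" for i
  proof -
    define h where "h t = (- 1) ^ i * g t" for t
    have h: "h (p i) > 0" "h (p (Suc i)) < 0"
      using sgn[of i] sgn[of "Suc i"] i unfolding h_def by auto
    have "continuous_on {p i..p (Suc i)} h"
      unfolding h_def by (intro continuous_intros continuous_on_subset[OF assms(1)]) auto
    then obtain c where c: "p i \<le> c" "c \<le> p (Suc i)" "h c = 0"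
      using IVT2'[of h "p (Suc i)" 0 "p i"] h assms(2)[OF i] by auto
    then have "p i \<noteq> c" "p (Suc i) \<noteq> c" "g c = 0"
      using h unfolding h_def by auto
    then show ?thesis
      using c by force
  qed
  then obtain c where c: "\<And>i. i < m \<Longrightarrow> p i < c i \<and> c i < p (Suc i) \<and> g (c i) = 0"
    by metis
  have p_mono: "p i \<le> p j" if "i \<le> j" "j \<le> m" for i j
    using that
  proof (induction j rule: dec_induct)
    case (step j)
    then show ?case using assms(2)[of j] by linarith
  qed simp
  have c_less: "c i < c j" if "i < j" "j < m" for i j
    using c[of i] c[of j] p_mono[of "Suc i" j] that by fastforce
  have "inj_on c {..<m}"
    by (rule inj_onI) (metis c_less lessThan_iff linorder_neqE_nat order_less_irrefl)
  then have "card (c ` {..<m}) = m"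
    by (simp add: card_image)
  moreover have "p 0 < c i \<and> c i < p m" if "i < m" for i
    using c[OF that] p_mono[of 0 i] p_mono[of "Suc i" m] that by auto
  ultimately show ?thesis
    using c by (intro that[of "c ` {..<m}"]) auto
qed

section \<open>Contacts with shifted cosines and the Lipschitz bound for the arccosine\<close>

text \<open>This isolates what the Lipschitz argument uses about zeros, so that the argument is
  shared by both kinds of maps. The same \<beta> is the phase of the cosine and the start of the
  period in which contacts are counted.\<close>

definition few_cosine_contacts :: "nat \<Rightarrow> (real \<Rightarrow> real) \<Rightarrow> bool" where
  "few_cosine_contacts d F \<longleftrightarrow>
     (\<forall>\<beta> S. finite S \<longrightarrow> S \<subseteq> {\<beta>..<\<beta> + 2 * pi} \<longrightarrow> (\<forall>t\<in>S. cos (real d * (t - \<beta>)) = F t) \<longrightarrow> card S \<le> 2 * d)"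

text \<open>A finite-difference form of the Bernstein-Szego inequality |F'| <= d sqrt (1 - F^2), for
  \<open>F\<close> that is only continuous. A larger rise of \<open>arccos F\<close> would let a
  shifted cosine cross the graph of \<open>F\<close> too often in one period.\<close>

lemma arccos_one_sided_lipschitz:
  fixes F :: "real \<Rightarrow> real"
  assumes "d \<ge> 1" "continuous_on UNIV F" and bound: "\<And>t. \<bar>F t\<bar> < 1"
    and contacts: "few_cosine_contacts d F" and "t0 < t1"
  shows "arccos (F t1) - arccos (F t0) \<le> real d * (t1 - t0)"
proof (rule ccontr)
  assume neg: "\<not> ?thesis"
  \<comment> \<open>The shift \<open>\<beta>\<close> is chosen such that \<open>cos (d (t - \<beta>)) - F t\<close> has the signs \<open>+, -, +, -\<close> at
    \<open>\<beta> < t0 < t1 < \<beta> + pi / d\<close>, and then alternates up to \<open>\<beta> + 2 pi\<close> because \<open>\<bar>F\<bar> < 1\<close>.\<close>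
  define \<epsilon> where "\<epsilon> = (arccos (F t1) - arccos (F t0) - real d * (t1 - t0)) / 2"
  have "\<epsilon> > 0"
    using neg unfolding \<epsilon>_def by simp
  have d: "real d > 0"
    using assms(1) by simp
  \<comment> \<open>Half of the excess is spent at each end: the phase of the cosine is
    \<open>arccos (F t0) + \<epsilon>\<close> at \<open>t0\<close> and
    \<open>arccos (F t1) - \<epsilon>\<close> at \<open>t1\<close>. As cos decreases on [0, pi], it
    lies below \<open>F\<close> at \<open>t0\<close> and above \<open>F\<close> at
    \<open>t1\<close>.\<close>
  define \<beta> where "\<beta> = t0 - (arccos (F t0) + \<epsilon>) / real d"
  define g where "g t = cos (real d * (t - \<beta>)) - F t" for t
  have x0: "real d * (t0 - \<beta>) = arccos (F t0) + \<epsilon>"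
    unfolding \<beta>_def using d by simp
  have x1: "real d * (t1 - \<beta>) = arccos (F t1) - \<epsilon>"
  proof -
    have "real d * (t1 - \<beta>) = real d * (t0 - \<beta>) + real d * (t1 - t0)"
      by (simp add: algebra_simps)
    moreover have "2 * \<epsilon> = arccos (F t1) - arccos (F t0) - real d * (t1 - t0)"
      unfolding \<epsilon>_def by simp
    ultimately show ?thesis
      using x0 by linarith
  qed
  have range: "0 < arccos (F t)" "arccos (F t) < pi" for t
    using arccos_lt_bounded[of "F t"] bound[of t] by auto
  have less: "real d * (t0 - \<beta>) < real d * (t1 - \<beta>)"
    using d assms(5) by simp
  have "cos (real d * (t0 - \<beta>)) < cos (arccos (F t0))"
    unfolding x0 using range[of t0] range[of t1] \<open>\<epsilon> > 0\<close> less x0 x1 by (intro cos_monotone_0_pi) auto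
  then have g0: "g t0 < 0"
    unfolding g_def using bound[of t0] by (simp add: cos_arccos_abs)
  have "cos (real d * (t1 - \<beta>)) > cos (arccos (F t1))"
    unfolding x1 using range[of t0] range[of t1] \<open>\<epsilon> > 0\<close> less x0 x1 by (intro cos_monotone_0_pi) auto
  then have g1: "g t1 > 0"
    unfolding g_def using bound[of t1] by (simp add: cos_arccos_abs)
  \<comment> \<open>At these extrema the cosine is \<open>(- 1) ^ j\<close>, which decides the sign
    of \<open>g\<close> because |F| < 1.\<close>
  define e where "e j = \<beta> + real j * (pi / real d)" for j :: nat
  have ge: "(- 1) ^ j * g (e j) > 0" for j
  proof -
    have "cos (real d * (e j - \<beta>)) = (- 1) ^ j"
      unfolding e_def using d by (simp add: cos_npi)
    then have "(- 1) ^ j * g (e j) = 1 - (- 1) ^ j * F (e j)"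
      unfolding g_def by (simp add: right_diff_distrib flip: power_mult_distrib)
    moreover have "\<bar>(- 1) ^ j * F (e j)\<bar> < 1"
      using bound[of "e j"] by (simp add: abs_mult)
    ultimately show ?thesis
      by linarith
  qed
  have "\<beta> < t0"
    unfolding \<beta>_def using range(1)[of t0] \<open>\<epsilon> > 0\<close> d by simp
  have "real d * (t1 - \<beta>) < pi"
    unfolding x1 using range(2)[of t1] \<open>\<epsilon> > 0\<close> by linarith
  then have "t1 < e 1"
    unfolding e_def using d by (simp add: field_simps)
  \<comment> \<open>Inserting \<open>t0\<close> and \<open>t1\<close> after
    \<open>e 0 = \<beta>\<close> shifts the later indices by 2, which preserves the alternation of
    signs. The points up to \<open>p (2 * d + 2) = e (2 * d)\<close> span one period and have 2 d +
    2 gaps, two more than the number of contacts allowed.\<close>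
  define p where "p i = (if i = 0 then \<beta> else if i = 1 then t0 else if i = 2 then t1 else e (i - 2))" for i :: nat
  have p_less: "p i < p (Suc i)" for i
  proof -
    consider "i = 0" | "i = 1" | "i = 2" | "i > 2" by linarith
    then show ?thesis
    proof cases
      case 4
      then have "e (Suc i - 2) = e (i - 2) + pi / real d"
        unfolding e_def using d by (simp add: Suc_diff_le field_simps)
      with 4 d show ?thesis
        unfolding p_def by simp
    qed (use \<open>\<beta> < t0\<close> \<open>t1 < e 1\<close> assms(5) in \<open>auto simp: p_def\<close>)
  qed
  have p_sgn: "(- 1) ^ i * g (p i) > 0" for i
  proof -
    consider "i = 0" | "i = 1" | "i = 2" | "i > 2" by linarith
    then show ?thesis
    proof cases
      case 1
      then show ?thesis
        using ge[of 0] by (simp add: p_def e_def)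
    next
      case 4
      then have "i = i - 2 + 2"
        by simp
      then have "(- 1 :: real) ^ i = (- 1) ^ (i - 2 + 2)"
        by metis
      also have "\<dots> = (- 1) ^ (i - 2)"
        by (simp only: power_add) simp
      finally have "(- 1 :: real) ^ i = (- 1) ^ (i - 2)" .
      with 4 ge[of "i - 2"] show ?thesis
        by (simp add: p_def)
    qed (use g0 g1 in \<open>auto simp: p_def\<close>)
  qed
  have cont_g: "continuous_on UNIV g"
    unfolding g_def by (intro continuous_intros assms(2))
  obtain S where S: "finite S" "card S = 2 * d + 2" "S \<subseteq> {p 0<..<p (2 * d + 2)}"
    "\<And>t. t \<in> S \<Longrightarrow> g t = 0"
    using alternating_signs_zeros[OF cont_g p_less p_sgn] by blast
  have "p 0 = \<beta>" "p (2 * d + 2) = \<beta> + 2 * pi"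
    using assms(1) by (auto simp: p_def e_def)
  with S have "card S \<le> 2 * d"
    using contacts[unfolded few_cosine_contacts_def, rule_format, of S \<beta>] unfolding g_def by force
  with S(2) show False
    by simp
qed

text \<open>For even \<open>F\<close> the reflection of \<open>t\<close> in 0 turns the bound on the
  rise of \<open>arccos F\<close> into a bound on its fall.\<close>

lemma arccos_lipschitz:
  fixes F :: "real \<Rightarrow> real"
  assumes "d \<ge> 1" "continuous_on UNIV F" "\<And>t. \<bar>F t\<bar> < 1"
    and "few_cosine_contacts d F" and even: "\<And>t. F (- t) = F t"
  shows "\<bar>arccos (F t1) - arccos (F t0)\<bar> \<le> real d * \<bar>t1 - t0\<bar>"
proof -
  have *: "\<bar>arccos (F t1) - arccos (F t0)\<bar> \<le> real d * (t1 - t0)" if "t0 < t1" for t0 t1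
    using arccos_one_sided_lipschitz[OF assms(1-4) that]
      arccos_one_sided_lipschitz[OF assms(1-4), of "- t1" "- t0"] that
    by (simp add: even abs_le_iff)
  consider "t0 < t1" | "t1 < t0" | "t0 = t1" by linarith
  then show ?thesis
    by cases (use *[of t0 t1] *[of t1 t0] in \<open>auto simp: abs_minus_commute\<close>)
qed

section \<open>Chebyshev points in the angular variable\<close>

definition chebyshev_points :: "nat \<Rightarrow> real set \<Rightarrow> bool" where
  "chebyshev_points N X \<longleftrightarrow> X = cheb_zeros N \<or> X = cheb_extrema N"

text \<open>In the variable \<open>t\<close> both families have spacing pi / N, and half of it is
  the claimed distance. The zeros start half a spacing from 0 and end half a spacing before pi; the
  extrema include both ends.\<close>

lemma chebyshev_points_near:
  assumes "N \<ge> 1" "chebyshev_points N X" "0 \<le> t" "t \<le> pi"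
  obtains t' where "cos t' \<in> X" "\<bar>t - t'\<bar> \<le> pi / (2 * real N)"
proof -
  define x where "x = t * real N / pi"
  have N: "real N > 0" using assms(1) by simp
  have x: "0 \<le> x" "x \<le> real N" "t = x * pi / real N"
    unfolding x_def using assms N by (auto simp: field_simps mult_left_mono)
  show ?thesis
  proof (cases "X = cheb_zeros N")
    case True
    \<comment> \<open>In the variable \<open>x\<close> the zero with index \<open>i\<close> is the
      midpoint of [i - 1, i]. The maximum covers \<open>x = 0\<close>, whose ceiling 0 is not an
      index.\<close>
    define i where "i = max 1 (nat \<lceil>x\<rceil>)"
    have i: "i \<in> {1..N}" "\<bar>2 * x - (2 * real i - 1)\<bar> \<le> 1"
      unfolding i_def using x assms(1) by (auto simp: max_def abs_le_iff, linarith+)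
    have "t - (2 * real i - 1) * pi / (2 * real N) = (2 * x - (2 * real i - 1)) * (pi / (2 * real N))"
      unfolding x(3) using N by (simp add: field_simps)
    then have "\<bar>t - (2 * real i - 1) * pi / (2 * real N)\<bar> = \<bar>2 * x - (2 * real i - 1)\<bar> * (pi / (2 * real N))"
      by (simp add: abs_mult)
    also have "\<dots> \<le> 1 * (pi / (2 * real N))"
      using i(2) by (intro mult_right_mono) auto
    finally show ?thesis
      using i(1) True by (intro that) (auto simp: cheb_zeros_def)
  next
    case False
    define i where "i = nat (round x)"
    have i: "i \<in> {0..N}" "\<bar>x - real i\<bar> \<le> 1 / 2"
      unfolding i_def using x of_int_round_abs_le[of x] by (auto simp: round_def abs_minus_commute, linarith+)
    have "t - real i * pi / real N = (x - real i) * (pi / real N)"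
      unfolding x(3) using N by (simp add: field_simps)
    then have "\<bar>t - real i * pi / real N\<bar> = \<bar>x - real i\<bar> * (pi / real N)"
      by (simp add: abs_mult)
    also have "\<dots> \<le> 1 / 2 * (pi / real N)"
      using i(2) by (intro mult_right_mono) auto
    finally show ?thesis
      using i(1) False assms(2) by (intro that) (auto simp: chebyshev_points_def cheb_extrema_def)
  qed
qed

lemma chebyshev_points_subset: "chebyshev_points N X \<Longrightarrow> X \<subseteq> {-1..1}"
  by (auto simp: chebyshev_points_def cheb_zeros_def cheb_extrema_def)

lemma finite_chebyshev_points: "chebyshev_points N X \<Longrightarrow> finite X"
  by (auto simp: chebyshev_points_def cheb_zeros_def cheb_extrema_def)

lemma card_chebyshev_points:
  assumes "chebyshev_points N X"
  shows "card X \<le> N + 1"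
proof -
  have "card (cheb_zeros N) \<le> card {1..N}" "card (cheb_extrema N) \<le> card {0..N}"
    unfolding cheb_zeros_def cheb_extrema_def by (intro card_image_le; simp)+
  with assms show ?thesis
    unfolding chebyshev_points_def by auto
qed

text \<open>The witness \<open>v\<close> is a node near a maximum point of |f|, whatever
  \<open>u\<close> is. The contact bound is assumed for all factors \<open>c\<close>, because the
  factor used depends on the value of \<open>f\<close> at that maximum point.\<close>

lemma chebyshev_points_norming:
  fixes f :: "real \<Rightarrow> complex"
  assumes "d \<ge> 1" "m > 1" "real N = m * real d" "chebyshev_points N X"
    and cont: "continuous_on {-1..1} f"
    and contacts: "\<And>c. (\<And>t. \<bar>Re (c * f (cos t))\<bar> < 1) \<Longrightarrow> few_cosine_contacts d (\<lambda>t. Re (c * f (cos t)))"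
    and "u \<in> {-1..1}"
  obtains v where "v \<in> X" "norm (f u) \<le> 1 / cos (pi / (2 * m)) * norm (f v)"
proof -
  define \<mu> where "\<mu> = pi / (2 * m)"
  have \<mu>: "0 < \<mu>" "\<mu> < pi / 2"
    using assms(2) unfolding \<mu>_def by (auto simp: field_simps)
  have "N \<ge> 1"
    using assms(1-3) by (cases N) auto
  obtain u' where u': "u' \<in> {-1..1}" "\<And>v. v \<in> {-1..1} \<Longrightarrow> norm (f v) \<le> norm (f u')"
    using continuous_attains_sup[of "{-1..1}" "\<lambda>v. norm (f v)"] cont continuous_on_norm by fastforce
  define M where "M = norm (f u')"
  define t where "t = arccos u'"
  have t: "0 \<le> t" "t \<le> pi" "cos t = u'"
    using u'(1) arccos_bounded unfolding t_def by auto
  obtain t' where t': "cos t' \<in> X" "\<bar>t - t'\<bar> \<le> pi / (2 * real N)"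
    using chebyshev_points_near[OF \<open>N \<ge> 1\<close> assms(4) t(1,2)] by blast
  have "M * cos \<mu> \<le> norm (f (cos t'))"
  proof (cases "M = 0")
    case False
    then have "M > 0"
      unfolding M_def by simp
    \<comment> \<open>Scaling by \<open>cos \<theta> < 1\<close> keeps \<open>\<bar>F\<bar> < 1\<close> strict; at the end \<open>\<theta>\<close> tends to 0.\<close>
    have "M * (cos (\<theta> + \<mu>) / cos \<theta>) \<le> norm (f (cos t'))" if \<theta>: "0 < \<theta>" "\<theta> < pi / 2 - \<mu>" for \<theta>
    proof -
      have cos: "0 < cos \<theta>" "cos \<theta> < 1"
        using \<theta> \<mu> cos_gt_zero cos_monotone_0_pi[of 0 \<theta>] by auto
      \<comment> \<open>The conjugated sign rotates the value of largest modulus onto the positive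
        axis. The real factor then gives \<open>F t = cos \<theta>\<close>, with |F| at most
        \<open>cos \<theta>\<close> everywhere.\<close>
      define c where "c = of_real (cos \<theta> / M) * cnj (sgn (f u'))"
      define F where "F s = Re (c * f (cos s))" for s
      have norm_c: "norm c = cos \<theta> / M"
        unfolding c_def norm_mult complex_mod_cnj using False cos \<open>M > 0\<close>
        by (simp add: norm_sgn norm_divide M_def)
      have F_le: "\<bar>F s\<bar> \<le> cos \<theta> / M * norm (f (cos s))" for s
        unfolding F_def using abs_Re_le_cmod[of "c * f (cos s)"] norm_c by (simp add: norm_mult)
      have bound: "\<bar>F s\<bar> < 1" for s
      proof -
        have "\<bar>F s\<bar> \<le> cos \<theta> / M * M"
          using u'(2)[of "cos s"] cos \<open>M > 0\<close> unfolding M_def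
          by (intro order_trans[OF F_le[unfolded M_def]] mult_left_mono) auto
        also have "\<dots> < 1"
          using cos \<open>M > 0\<close> by simp
        finally show ?thesis .
      qed
      have "cnj (sgn (f u')) * f u' = of_real M"
        unfolding M_def sgn_eq using complex_norm_square[of "f u'"] \<open>M > 0\<close>
        by (simp add: field_simps power2_eq_square M_def)
      then have "c * f u' = of_real (cos \<theta>)"
        unfolding c_def using \<open>M > 0\<close> by (simp add: mult.assoc)
      then have Ft: "F t = cos \<theta>"
        unfolding F_def t(3) by simp
      have "continuous_on UNIV F"
        unfolding F_def by (intro continuous_intros continuous_on_compose2[OF cont]) auto
      then have "\<bar>arccos (F t') - arccos (F t)\<bar> \<le> real d * \<bar>t' - t\<bar>"
        using bound contacts unfolding F_def by (intro arccos_lipschitz[OF assms(1)]) auto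
      also have "\<dots> \<le> real d * (pi / (2 * real N))"
        using t'(2) by (intro mult_left_mono) auto
      also have "\<dots> = \<mu>"
        unfolding \<mu>_def assms(3) using assms(1,2) by (simp add: field_simps)
      finally have "arccos (F t') \<le> \<theta> + \<mu>"
        using \<theta> \<mu> unfolding Ft by (simp add: arccos_cos)
      moreover have "0 \<le> arccos (F t')"
        using bound[of t'] by (intro arccos_lbound) auto
      ultimately have "cos (\<theta> + \<mu>) \<le> cos (arccos (F t'))"
        using \<theta> \<mu> by (intro cos_monotone_0_pi_le) auto
      also have "\<dots> = F t'"
        using bound[of t'] by (simp add: cos_arccos_abs)
      also have "\<dots> \<le> cos \<theta> / M * norm (f (cos t'))"
        using F_le[of t'] by simp
      finally show ?thesis
        using cos \<open>M > 0\<close> by (simp add: field_simps)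
    qed
    moreover have "eventually (\<lambda>\<theta>. 0 < \<theta> \<and> \<theta> < pi / 2 - \<mu>) (at_right 0)"
      using \<mu> unfolding eventually_at_right_field by (intro exI[of _ "pi / 2 - \<mu>"]) auto
    ultimately have "eventually (\<lambda>\<theta>. M * (cos (\<theta> + \<mu>) / cos \<theta>) \<le> norm (f (cos t'))) (at_right 0)"
      by (auto elim: eventually_mono)
    moreover have "((\<lambda>\<theta>. M * (cos (\<theta> + \<mu>) / cos \<theta>)) \<longlongrightarrow> M * (cos (0 + \<mu>) / cos 0)) (at_right 0)"
      by (intro tendsto_intros) auto
    ultimately show ?thesis
      using tendsto_upperbound by fastforce
  qed simp
  moreover have "cos \<mu> > 0"
    using \<mu> by (intro cos_gt_zero) auto
  ultimately have "M \<le> 1 / cos \<mu> * norm (f (cos t'))"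
    by (simp add: field_simps)
  then show ?thesis
    using t'(1) u'(2)[OF assms(7)] by (intro that[of "cos t'"]) (auto simp: M_def \<mu>_def)
qed

section \<open>Arcs and meshes\<close>

text \<open>At \<beta> the cosine is 1 and \<open>F\<close> is not, so the difference is not
  identically 0 and its zeros can be counted.\<close>

lemma few_cosine_contacts_cis_poly:
  assumes "cis_poly d (\<lambda>t. of_real (F t))" "\<And>t. \<bar>F t\<bar> < 1"
  shows "few_cosine_contacts d F"
  unfolding few_cosine_contacts_def
proof (intro allI impI)
  fix \<beta> S
  assume S: "finite S" "S \<subseteq> {\<beta>..<\<beta> + 2 * pi}" "\<forall>t\<in>S. cos (real d * (t - \<beta>)) = F t"
  have "F \<beta> \<noteq> 1"
    using assms(2)[of \<beta>] by auto
  then show "card S \<le> 2 * d"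
    using S
    by (intro cis_poly_card_zeros[OF cis_poly_diff[OF cis_poly_cos_shift[of d \<beta>] assms(1)], of \<beta> S \<beta>]) auto
qed

text \<open>For even \<open>d\<close> the cosine has period pi and fits into the part without the
  radical. It equals 1 at both \<beta> and \<beta> + pi, so the difference vanishes at neither
  point, as the zero count requires.\<close>

lemma few_cosine_contacts_radical_poly:
  assumes "\<bar>x\<bar> \<le> 1" "d \<ge> 1" "even d" "radical_poly x d (\<lambda>t. of_real (F t))" "\<And>t. \<bar>F t\<bar> < 1"
  shows "few_cosine_contacts d F"
  unfolding few_cosine_contacts_def
proof (intro allI impI)
  fix \<beta> S
  assume S: "finite S" "S \<subseteq> {\<beta>..<\<beta> + 2 * pi}" "\<forall>t\<in>S. cos (real d * (t - \<beta>)) = F t"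
  obtain e where e: "d = 2 * e"
    using assms(3) by blast
  have shift: "cos (real d * (t + pi - \<beta>)) = cos (real d * (t - \<beta>))" for t
  proof -
    have "real d * (t + pi - \<beta>) = real d * (t - \<beta>) + 2 * real e * pi"
      unfolding e by (simp add: algebra_simps)
    then show ?thesis
      by (simp only: cos_add cos_2npi sin_2npi mult_1_right mult_zero_right diff_zero)
  qed
  have "radical_poly x d (\<lambda>t. complex_of_real (cos (real d * (t - \<beta>))))"
    by (intro radical_poly_of_periodic cis_poly_cos_shift) (simp only: shift)
  from radical_poly_add[OF this radical_poly_cmult[OF assms(4), of "- 1"]]
  have G: "radical_poly x d (\<lambda>t. of_real (cos (real d * (t - \<beta>)) - F t))"
    by simp
  have "F \<beta> \<noteq> 1" "F (\<beta> + pi) \<noteq> 1"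
    using assms(5)[of \<beta>] assms(5)[of "\<beta> + pi"] by auto
  then show "card S \<le> 2 * d"
    using S shift[of \<beta>] by (intro radical_poly_card_zeros[OF assms(1,2) G, of \<beta> S \<beta>]) auto
qed

lemma trig_poly_of_degree_le_cis_poly:
  assumes "trig_poly_of_degree_le \<nu> f"
  shows "cis_poly \<nu> f"
proof -
  obtain c \<alpha> \<beta> where f: "f = (\<lambda>t. c + (\<Sum>j=1..\<nu>. \<alpha> j * complex_of_real (cos (real j * t))
      + \<beta> j * complex_of_real (sin (real j * t))))"
    using assms unfolding trig_poly_of_degree_le_def by blast
  have "cis_poly \<nu> (\<lambda>t. of_real (cos (real j * t)))" if "j \<in> {1..\<nu>}" for j
    using cis_poly_mono[OF cis_poly_cos_shift[of j 0], of \<nu>] that by simp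
  moreover have "cis_poly \<nu> (\<lambda>t. of_real (sin (real j * t)))" if "j \<in> {1..\<nu>}" for j
  proof -
    have "cos (real j * (t - pi / (2 * real j))) = sin (real j * t)" for t
      using that by (simp add: right_diff_distrib sin_cos_eq) (metis cos_minus minus_diff_eq)
    then show ?thesis
      using cis_poly_mono[OF cis_poly_cos_shift[of j "pi / (2 * real j)"], of \<nu>] that by simp
  qed
  ultimately show ?thesis
    unfolding f by (intro cis_poly_add cis_poly_const cis_poly_sum cis_poly_cmult)
qed

text \<open>The cosine and sine of \<open>j\<close> times the mapped variable are real parts of
  constant multiples of \<open>E t ^ j\<close>, and \<open>E\<close> has degree 2 in the radical
  sense. This is the source of the factor 2 in the number of nodes for trigonometric maps.\<close>

lemma trig_poly_of_degree_le_radical_poly: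
  assumes "\<bar>x\<bar> \<le> 1" "trig_poly_of_degree_le \<nu> f"
  shows "radical_poly x (2 * \<nu>) (\<lambda>t. f (2 * arcsin (x * cos t) + t0))"
proof -
  obtain c \<alpha> \<beta> where f: "f = (\<lambda>t. c + (\<Sum>j=1..\<nu>. \<alpha> j * complex_of_real (cos (real j * t))
      + \<beta> j * complex_of_real (sin (real j * t))))"
    using assms unfolding trig_poly_of_degree_le_def by blast
  define E where "E t = cis (2 * arcsin (x * cos t))" for t
  have power: "radical_poly x (2 * \<nu>) (\<lambda>t. of_real (Re (w * E t ^ j)))" if "j \<in> {1..\<nu>}" for j w
    unfolding E_def using that
    by (intro radical_poly_Re radical_poly_cmult radical_poly_power[OF assms(1) _ radical_poly_cis_arcsin[OF assms(1)]])
      auto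
  have pow: "cis (real j * t0) * E t ^ j = cis (real j * (2 * arcsin (x * cos t) + t0))" for j t
    unfolding E_def Complex.DeMoivre cis_mult by (simp add: algebra_simps)
  have cos: "cos (real j * (2 * arcsin (x * cos t) + t0)) = Re (cis (real j * t0) * E t ^ j)" for j t
    unfolding pow by simp
  have sin: "sin (real j * (2 * arcsin (x * cos t) + t0)) = Re (- \<i> * cis (real j * t0) * E t ^ j)" for j t
    unfolding mult.assoc pow by simp
  show ?thesis
    unfolding f cos sin
    by (intro radical_poly_add radical_poly_const radical_poly_sum radical_poly_cmult power)
qed

lemma radical_poly_poly:
  assumes "\<bar>x\<bar> \<le> 1" "d \<ge> 1" "radical_poly x d f" "degree p \<le> n"
  shows "radical_poly x (n * d) (\<lambda>t. poly p (f t))"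
proof -
  have "radical_poly x (n * d) (\<lambda>t. \<Sum>i\<le>n. coeff p i * f t ^ i)"
    by (intro radical_poly_sum radical_poly_cmult radical_poly_power[OF assms(1-3)]) simp
  then show ?thesis
    using poly_eq_sum[OF assms(4)] by presburger
qed

section \<open>Parametrized arcs and norming by their mapped points\<close>

definition admissible_arc :: "map_kind \<Rightarrow> (real \<Rightarrow> complex) \<Rightarrow> real \<Rightarrow> real \<Rightarrow> nat \<Rightarrow> bool" where
  "admissible_arc knd z a b k \<longleftrightarrow> a < b \<and> k \<ge> 1 \<and>
     (knd = Algebraic \<and> algebraic_poly_of_degree k z \<or>
      knd = Trigonometric \<and> trig_poly_of_degree k z \<and> b - a \<le> 2 * pi)"

text \<open>In the trigonometric case a point whose offset from the midpoint is
  \<open>2 * \<theta>\<close> comes from \<open>u = sin \<theta> / sin \<omega>\<close>. The bound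
  on \<open>b - a\<close> gives \<omega> <= pi / 2, so sin is increasing on the range of \<theta>
  and arcsin inverts it.\<close>

lemma sigma_image:
  assumes "a < b" "knd = Trigonometric \<Longrightarrow> b - a \<le> 2 * pi"
  shows "sigma knd a b ` {-1..1} = {a..b}"
proof (cases knd)
  case Algebraic
  show ?thesis
  proof (intro equalityI subsetI)
    fix t assume "t \<in> sigma knd a b ` {-1..1}"
    then obtain u where u: "-1 \<le> u" "u \<le> 1" "t = (b - a) / 2 * u + (b + a) / 2"
      using Algebraic by auto
    then have "(b - a) / 2 * (-1) \<le> (b - a) / 2 * u" "(b - a) / 2 * u \<le> (b - a) / 2 * 1"
      using assms(1) by (intro mult_left_mono; simp)+
    then show "t \<in> {a..b}"
      unfolding u(3) by (simp add: field_simps)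
  next
    fix t assume "t \<in> {a..b}"
    then show "t \<in> sigma knd a b ` {-1..1}"
      using assms(1) Algebraic
      by (intro image_eqI[of _ _ "(2 * t - (b + a)) / (b - a)"]) (auto simp: field_simps)
  qed
next
  case Trigonometric
  define \<omega> where "\<omega> = (b - a) / 4"
  have \<omega>: "0 < \<omega>" "\<omega> \<le> pi / 2"
    using assms Trigonometric unfolding \<omega>_def by auto
  have sin: "0 < sin \<omega>" "sin \<omega> \<le> 1"
    using \<omega> by (auto intro: sin_gt_zero)
  have ab: "a = (b + a) / 2 - 2 * \<omega>" "b = (b + a) / 2 + 2 * \<omega>"
    unfolding \<omega>_def by (simp_all add: field_simps)
  show ?thesis
  proof (intro equalityI subsetI)
    fix t assume "t \<in> sigma knd a b ` {-1..1}"
    then obtain u where u: "-1 \<le> u" "u \<le> 1" "t = 2 * arcsin (u * sin \<omega>) + (b + a) / 2"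
      using Trigonometric unfolding \<omega>_def by auto
    have *: "- sin \<omega> \<le> u * sin \<omega>" "u * sin \<omega> \<le> sin \<omega>"
      using mult_right_mono[OF u(1), of "sin \<omega>"] mult_right_mono[OF u(2), of "sin \<omega>"] sin by auto
    have "- 1 \<le> u * sin \<omega>" "u * sin \<omega> \<le> 1"
      using * sin by linarith+
    then have "arcsin (sin (- \<omega>)) \<le> arcsin (u * sin \<omega>)" "arcsin (u * sin \<omega>) \<le> arcsin (sin \<omega>)"
      using * sin by (intro arcsin_le_arcsin; simp only: sin_minus; linarith)+
    moreover have "arcsin (sin (- \<omega>)) = - \<omega>" "arcsin (sin \<omega>) = \<omega>"
      using \<omega> by (intro arcsin_sin; linarith)+
    ultimately have "- \<omega> \<le> arcsin (u * sin \<omega>)" "arcsin (u * sin \<omega>) \<le> \<omega>"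
      by linarith+
    then show "t \<in> {a..b}"
      using ab unfolding u(3) by auto
  next
    fix t assume t: "t \<in> {a..b}"
    define \<theta> where "\<theta> = (t - (b + a) / 2) / 2"
    have \<theta>: "- \<omega> \<le> \<theta>" "\<theta> \<le> \<omega>"
      using t unfolding \<theta>_def \<omega>_def by (auto simp: field_simps)
    have "sin (- \<omega>) \<le> sin \<theta>" "sin \<theta> \<le> sin \<omega>"
      using \<theta> \<omega> by (intro sin_monotone_2pi_le; simp)+
    then have "sin \<theta> / sin \<omega> \<in> {-1..1}"
      using sin by (auto simp: field_simps)
    moreover have "t = sigma knd a b (sin \<theta> / sin \<omega>)"
    proof -
      have "arcsin (sin \<theta>) = \<theta>"
        using \<theta> \<omega> by (intro arcsin_sin) auto
      then show ?thesis
        using Trigonometric sin unfolding \<theta>_def by (simp add: \<omega>_def[symmetric])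
    qed
    ultimately show "t \<in> sigma knd a b ` {-1..1}"
      by blast
  qed
qed

lemma continuous_on_arc:
  assumes "admissible_arc knd z a b k"
  shows "continuous_on S z"
  using assms
  unfolding admissible_arc_def algebraic_poly_of_degree_def trig_poly_of_degree_def trig_poly_of_degree_le_def
  by (auto intro!: continuous_intros)

text \<open>With a finite image, some value would be taken infinitely often, and counting zeros
  would make the map constant, against \<open>k \<ge> 1\<close>. The infinite image makes \<Gamma>
  polynomially determining.\<close>

lemma infinite_arc:
  assumes "admissible_arc knd z a b k"
  shows "infinite (z ` {a..b})"
proof
  assume "finite (z ` {a..b})"
  \<comment> \<open>Dropping the right end makes the interval fit into one half-open period even if
    \<open>b - a = 2 * pi\<close>.\<close>
  then have "finite (z ` {a..<b})"
    by (rule rev_finite_subset) auto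
  moreover have "infinite {a..<b}"
    using assms unfolding admissible_arc_def by (simp add: infinite_Ico)
  ultimately obtain t0 where inf: "infinite {t \<in> {a..<b}. z t = z t0}"
    using pigeonhole_infinite by blast
  consider (alg) q where "degree q = k" "z = (\<lambda>t. poly q (of_real t))"
    | (trig) "trig_poly_of_degree k z" "b - a \<le> 2 * pi"
    using assms unfolding admissible_arc_def algebraic_poly_of_degree_def by blast
  then show False
  proof cases
    case alg
    have "infinite (complex_of_real ` {t \<in> {a..<b}. z t = z t0})"
      using inf by (simp add: finite_image_iff inj_on_def)
    moreover have "complex_of_real ` {t \<in> {a..<b}. z t = z t0} \<subseteq> {w. poly (q - [:z t0:]) w = 0}"
      unfolding alg(2) by auto
    ultimately have "infinite {w. poly (q - [:z t0:]) w = 0}"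
      using infinite_super by blast
    then have "q - [:z t0:] = 0"
      using poly_roots_finite by blast
    then have "degree q = 0"
      by (metis degree_pCons_0 eq_iff_diff_eq_0)
    with alg(1) assms show False
      unfolding admissible_arc_def by simp
  next
    case trig
    have "cis_poly k z"
      using trig(1) trig_poly_of_degree_le_cis_poly unfolding trig_poly_of_degree_def by blast
    then have cp: "cis_poly k (\<lambda>t. z t - z t0)"
      by (rule cis_poly_diff[OF _ cis_poly_const])
    obtain S where S: "S \<subseteq> {t \<in> {a..<b}. z t = z t0}" "finite S" "card S = 2 * k + 1"
      using infinite_arbitrarily_large[OF inf] by blast
    have "z t - z t0 = 0" for t
    proof (rule ccontr)
      assume "z t - z t0 \<noteq> 0"
      then have "card S \<le> 2 * k"
        using S(1) trig(2) by (intro cis_poly_card_zeros[OF cp _ S(2), of t a]) auto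
      with S(3) show False by simp
    qed
    then have "z = (\<lambda>t. z t0)"
      by auto
    then have "trig_poly_of_degree_le 0 z"
      unfolding trig_poly_of_degree_le_def by auto
    with trig(1) assms show False
      unfolding trig_poly_of_degree_def admissible_arc_def by auto
  qed
qed

lemma num_nodes_eq:
  assumes "num_nodes knd m n k \<in> \<int>" "m > 1"
  shows "real (nat \<lfloor>num_nodes knd m n k\<rfloor>) = num_nodes knd m n k"
proof -
  have "num_nodes knd m n k \<ge> 0"
    using assms(2) by (cases knd) auto
  with assms(1) show ?thesis
    by (auto elim!: Ints_cases)
qed

lemma num_nodes_ge_1:
  assumes "num_nodes knd m n k \<in> \<int>" "m > 1" "n \<ge> 1" "k \<ge> 1"
  shows "nat \<lfloor>num_nodes knd m n k\<rfloor> \<ge> 1"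
proof -
  have "num_nodes knd m n k > 0"
    using assms(2-4) by (cases knd) auto
  then have "real (nat \<lfloor>num_nodes knd m n k\<rfloor>) > 0"
    by (simp only: num_nodes_eq[OF assms(1,2)])
  then have "nat \<lfloor>num_nodes knd m n k\<rfloor> > 0"
    by (simp only: of_nat_0_less_iff)
  then show ?thesis
    by linarith
qed

lemma arc_norming:
  assumes arc: "admissible_arc knd z a b k"
    and "n \<ge> 1" "m > 1" and int: "num_nodes knd m n k \<in> \<int>"
    and T: "chebyshev_points (nat \<lfloor>num_nodes knd m n k\<rfloor>) (T (nat \<lfloor>num_nodes knd m n k\<rfloor>))"
    and "degree p \<le> n" "w \<in> z ` {a..b}"
  obtains v where "v \<in> mapped_points T knd z a b k m n"
    "norm (poly p w) \<le> 1 / cos (pi / (2 * m)) * norm (poly p v)"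
proof -
  have "a < b" "k \<ge> 1" and period: "knd = Trigonometric \<Longrightarrow> b - a \<le> 2 * pi"
    using arc unfolding admissible_arc_def by auto
  define f where "f u = poly p (z (sigma knd a b u))" for u
  \<comment> \<open>The degree bound for \<open>f (cos t)\<close>, chosen so that the number of
    nodes is \<open>m * d\<close>. It is even in the trigonometric case, as the contact bound with a
    radical demands.\<close>
  define d where "d = (case knd of Algebraic \<Rightarrow> n * k | Trigonometric \<Rightarrow> n * (2 * k))"
  have "d \<ge> 1"
    using \<open>k \<ge> 1\<close> \<open>n \<ge> 1\<close> unfolding d_def by (cases knd) auto
  have N: "real (nat \<lfloor>num_nodes knd m n k\<rfloor>) = m * real d"
    unfolding num_nodes_eq[OF int \<open>m > 1\<close>] d_def by (cases knd) auto
  have sin_le: "\<bar>u * sin ((b - a) / 4)\<bar> \<le> 1" if "u \<in> {-1..1}" for u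
  proof -
    have "\<bar>u\<bar> \<le> 1"
      using that by auto
    then have "\<bar>u\<bar> * \<bar>sin ((b - a) / 4)\<bar> \<le> 1 * 1"
      by (intro mult_mono) auto
    then show ?thesis
      by (simp only: abs_mult mult_1)
  qed
  have "continuous_on {-1..1} (sigma knd a b)"
  proof (cases knd)
    case Trigonometric
    have "\<forall>u\<in>{-1..1}. - 1 \<le> u * sin ((b - a) / 4) \<and> u * sin ((b - a) / 4) \<le> 1"
      using sin_le by (meson abs_le_D1 abs_le_iff minus_le_iff)
    moreover have "sigma knd a b = (\<lambda>u. 2 * arcsin (u * sin ((b - a) / 4)) + (b + a) / 2)"
      unfolding Trigonometric by (intro ext sigma.simps)
    ultimately show ?thesis
      by (simp only:) (intro continuous_intros)
  next
    case Algebraic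
    have "sigma knd a b = (\<lambda>u. (b - a) / 2 * u + (b + a) / 2)"
      unfolding Algebraic by (intro ext sigma.simps)
    then show ?thesis
      by (simp only:) (intro continuous_intros)
  qed
  then have cont: "continuous_on {-1..1} f"
    unfolding f_def
    by (intro continuous_on_poly continuous_on_compose2[OF continuous_on_arc[OF arc, of UNIV]]) auto
  have contacts: "few_cosine_contacts d (\<lambda>t. Re (c * f (cos t)))"
    if bound: "\<And>t. \<bar>Re (c * f (cos t))\<bar> < 1" for c
  proof (cases knd)
    case Algebraic
    then obtain q where q: "degree q = k" "z = (\<lambda>t. poly q (of_real t))"
      using arc unfolding admissible_arc_def algebraic_poly_of_degree_def by auto
    define l where "l = [:complex_of_real ((b + a) / 2), complex_of_real ((b - a) / 2):]"
    have "degree (pcompose p (pcompose q l)) \<le> n * k"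
    proof -
      have "degree (pcompose p (pcompose q l)) \<le> degree p * (degree q * degree l)"
        by (intro order_trans[OF degree_pcompose_le] mult_left_mono degree_pcompose_le) auto
      also have "\<dots> \<le> n * (k * 1)"
        using \<open>degree p \<le> n\<close> q(1) unfolding l_def by (intro mult_le_mono) auto
      finally show ?thesis by simp
    qed
    then have "cis_poly (n * k) (\<lambda>t. poly (pcompose p (pcompose q l)) (of_real (cos t)))"
      by (rule cis_poly_poly_cos)
    moreover have "poly (pcompose p (pcompose q l)) (of_real (cos t)) = f (cos t)" for t
      unfolding f_def q(2) l_def using Algebraic by (simp add: poly_pcompose mult_ac add_ac)
    ultimately have "cis_poly d (\<lambda>t. of_real (Re (c * f (cos t))))"
      unfolding d_def using Algebraic by (intro cis_poly_Re cis_poly_cmult) simp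
    then show ?thesis
      using bound by (rule few_cosine_contacts_cis_poly)
  next
    case Trigonometric
    define x where "x = sin ((b - a) / 4)"
    have x: "\<bar>x\<bar> \<le> 1"
      unfolding x_def by simp
    have "trig_poly_of_degree_le k z"
      using arc Trigonometric unfolding admissible_arc_def trig_poly_of_degree_def by auto
    then have "radical_poly x (n * (2 * k)) (\<lambda>t. poly p (z (2 * arcsin (x * cos t) + (b + a) / 2)))"
      using \<open>k \<ge> 1\<close> \<open>degree p \<le> n\<close>
      by (intro radical_poly_poly trig_poly_of_degree_le_radical_poly x) auto
    moreover have "poly p (z (2 * arcsin (x * cos t) + (b + a) / 2)) = f (cos t)" for t
      unfolding f_def x_def using Trigonometric by (simp add: mult.commute)
    ultimately have "radical_poly x d (\<lambda>t. of_real (Re (c * f (cos t))))"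
      unfolding d_def using Trigonometric by (intro radical_poly_Re radical_poly_cmult) simp
    moreover have "even d"
      unfolding d_def using Trigonometric by simp
    ultimately show ?thesis
      using x bound \<open>d \<ge> 1\<close> by (intro few_cosine_contacts_radical_poly)
  qed
  obtain u where u: "u \<in> {-1..1}" "w = z (sigma knd a b u)"
    using \<open>w \<in> z ` {a..b}\<close> sigma_image[OF \<open>a < b\<close> period] by (metis image_iff)
  obtain v where "v \<in> T (nat \<lfloor>num_nodes knd m n k\<rfloor>)"
    "norm (f u) \<le> 1 / cos (pi / (2 * m)) * norm (f v)"
    using chebyshev_points_norming[OF \<open>d \<ge> 1\<close> \<open>m > 1\<close> N T cont contacts u(1)] by blast
  then show ?thesis
    using u(2) by (intro that[of "z (sigma knd a b v)"]) (auto simp: mapped_points_def f_def)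
qed

section \<open>Sup norms, the outer boundary and passage to larger compact sets\<close>

lemma sup_norm_leI:
  assumes "finite Y" "C \<ge> 0" "\<And>x. x \<in> X \<Longrightarrow> \<exists>y\<in>Y. norm (f x) \<le> C * norm (f y)"
  shows "sup_norm X f \<le> C * sup_norm Y f"
proof (cases "X = {}")
  case True
  have "0 \<le> sup_norm Y f"
  proof (cases "Y = {}")
    case False
    then obtain y where "y \<in> Y" by blast
    then have "norm (f y) \<le> sup_norm Y f"
      unfolding sup_norm_def using assms(1) by (auto intro!: cSUP_upper)
    then show ?thesis
      using norm_ge_zero order_trans by blast
  qed (simp add: sup_norm_def)
  with True assms(2) show ?thesis
    by (simp add: sup_norm_def)
next
  case False
  have "norm (f x) \<le> C * sup_norm Y f" if "x \<in> X" for x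
  proof -
    obtain y where y: "y \<in> Y" "norm (f x) \<le> C * norm (f y)"
      using assms(3)[OF \<open>x \<in> X\<close>] by blast
    have "norm (f y) \<le> sup_norm Y f"
      unfolding sup_norm_def using assms(1) y(1) by (auto intro!: cSUP_upper)
    then show ?thesis
      using y(2) mult_left_mono[OF _ assms(2)] order_trans by blast
  qed
  with False show ?thesis
    unfolding sup_norm_def[of X] by (auto intro: cSUP_least)
qed

text \<open>The set \<open>- outside K\<close> is \<open>K\<close> with its holes filled. It is
  bounded and its frontier is the outer boundary of \<open>K\<close>, so the maximum modulus
  principle on it bounds \<open>p\<close> on \<open>K\<close> by the values on \<Gamma>.\<close>

lemma sup_norm_outer_boundary:
  assumes "compact K" "outer_boundary K \<subseteq> \<Gamma>" "compact \<Gamma>" "\<Gamma> \<noteq> {}" "K \<noteq> {}"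
  shows "sup_norm K (poly p) \<le> sup_norm \<Gamma> (poly p)"
proof -
  define S where "S = - outside K"
  have "closed S"
    unfolding S_def by (intro closed_Compl open_outside compact_imp_closed assms(1))
  have "bounded S"
    unfolding S_def using assms(1) cobounded_outside[of K] compact_imp_bounded by auto
  have "K \<subseteq> S"
    unfolding S_def using outside_no_overlap[of K] by blast
  have upper: "norm (poly p w) \<le> sup_norm \<Gamma> (poly p)" if "w \<in> \<Gamma>" for w
  proof -
    have "compact ((\<lambda>w. norm (poly p w)) ` \<Gamma>)"
      by (intro compact_continuous_image assms(3) continuous_intros)
    then have "bdd_above ((\<lambda>w. norm (poly p w)) ` \<Gamma>)"
      by (simp add: compact_imp_bounded bounded_imp_bdd_above)
    then show ?thesis
      using that unfolding sup_norm_def by (auto intro: cSUP_upper)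
  qed
  have "norm (poly p w) \<le> sup_norm \<Gamma> (poly p)" if "w \<in> K" for w
  proof (rule maximum_modulus_frontier[where S = S and f = "poly p"])
    show "\<And>w. w \<in> frontier S \<Longrightarrow> norm (poly p w) \<le> sup_norm \<Gamma> (poly p)"
      using assms(2) upper unfolding S_def outer_boundary_def frontier_complement by blast
  qed (use that \<open>K \<subseteq> S\<close> \<open>bounded S\<close> in \<open>auto intro: holomorphic_intros continuous_intros\<close>)
  then show ?thesis
    using assms(5) unfolding sup_norm_def[of K] by (auto intro: cSUP_least)
qed

lemma polynomially_determining_infinite:
  assumes "infinite K"
  shows "polynomially_determining K"
  unfolding polynomially_determining_def
proof (intro allI impI)
  fix p w
  assume "\<forall>w\<in>K. poly p w = 0"
  then have "K \<subseteq> {w. poly p w = 0}"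
    by blast
  then have "p = 0"
    using assms finite_subset poly_roots_finite by blast
  then show "poly p w = 0"
    by simp
qed

lemma mapped_points_finite_card:
  assumes "chebyshev_points (nat \<lfloor>num_nodes knd m n k\<rfloor>) (T (nat \<lfloor>num_nodes knd m n k\<rfloor>))"
  shows "finite (mapped_points T knd z a b k m n)"
    and "card (mapped_points T knd z a b k m n) \<le> nat \<lfloor>num_nodes knd m n k\<rfloor> + 1"
proof -
  have fin: "finite (T (nat \<lfloor>num_nodes knd m n k\<rfloor>))"
    using finite_chebyshev_points[OF assms] .
  then show "finite (mapped_points T knd z a b k m n)"
    unfolding mapped_points_def by simp
  have "card (mapped_points T knd z a b k m n) \<le> card (T (nat \<lfloor>num_nodes knd m n k\<rfloor>))"
    unfolding mapped_points_def using fin card_image_le finite_imageI order_trans by metis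
  with card_chebyshev_points[OF assms] show "card (mapped_points T knd z a b k m n) \<le> nat \<lfloor>num_nodes knd m n k\<rfloor> + 1"
    by linarith
qed

lemma mapped_points_subset:
  assumes "admissible_arc knd z a b k"
    and "chebyshev_points (nat \<lfloor>num_nodes knd m n k\<rfloor>) (T (nat \<lfloor>num_nodes knd m n k\<rfloor>))"
  shows "mapped_points T knd z a b k m n \<subseteq> z ` {a..b}"
proof -
  have "sigma knd a b ` {-1..1} = {a..b}"
    using assms(1) unfolding admissible_arc_def by (intro sigma_image) auto
  then show ?thesis
    using chebyshev_points_subset[OF assms(2)] unfolding mapped_points_def by blast
qed

text \<open>The constant and the growth exponent carry over unchanged, because \<Gamma> already
  controls the sup norm of polynomials on \<open>K\<close>.\<close>

lemma polynomial_mesh_mono_set: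
  assumes "polynomial_mesh \<alpha> \<Gamma> Z" "compact K" "\<Gamma> \<subseteq> K" "infinite \<Gamma>" "outer_boundary K \<subseteq> \<Gamma>"
  shows "polynomial_mesh \<alpha> K Z"
proof -
  have *: "compact \<Gamma>" "\<And>n. n \<ge> 1 \<Longrightarrow> finite (Z n) \<and> Z n \<subseteq> \<Gamma>" "(\<lambda>n. real (card (Z n))) \<in> O(\<lambda>n. real n powr \<alpha>)"
    using assms(1) unfolding polynomial_mesh_def by auto
  obtain c where c: "\<And>n p. n \<ge> 1 \<Longrightarrow> degree p \<le> n \<Longrightarrow> sup_norm \<Gamma> (poly p) \<le> c * sup_norm (Z n) (poly p)"
    using assms(1) unfolding polynomial_mesh_def by blast
  have "infinite K" "\<Gamma> \<noteq> {}" "K \<noteq> {}"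
    using assms(3,4) infinite_super by auto
  then have "sup_norm K (poly p) \<le> sup_norm \<Gamma> (poly p)" for p
    using assms * by (intro sup_norm_outer_boundary) auto
  then have "\<exists>c. \<forall>n\<ge>1. \<forall>p. degree p \<le> n \<longrightarrow> sup_norm K (poly p) \<le> c * sup_norm (Z n) (poly p)"
    using c by (meson order_trans)
  moreover have "polynomially_determining K"
    using \<open>infinite K\<close> by (rule polynomially_determining_infinite)
  ultimately show ?thesis
    unfolding polynomial_mesh_def using * assms(2,3) by blast
qed

section \<open>The norming inequality and the mesh properties for a union of arcs\<close>

theorem mainTheorem2:
  fixes s :: nat
    and knd :: "nat \<Rightarrow> map_kind"
    and z :: "nat \<Rightarrow> real \<Rightarrow> complex"
    and a b :: "nat \<Rightarrow> real"
    and k :: "nat \<Rightarrow> nat"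
    and T :: "nat \<Rightarrow> real set"
    and \<Gamma> :: "complex set"
    and Z :: "real \<Rightarrow> nat \<Rightarrow> complex set"
  assumes "s \<ge> 1"
    and "\<And>j. j \<in> {1..s} \<Longrightarrow> a j < b j"
    and "\<And>j. j \<in> {1..s} \<Longrightarrow> k j \<ge> 1"
    and "\<And>j. j \<in> {1..s} \<Longrightarrow>
           (knd j = Algebraic \<and> algebraic_poly_of_degree (k j) (z j)) \<or>
           (knd j = Trigonometric \<and> trig_poly_of_degree (k j) (z j) \<and> b j - a j \<le> 2 * pi)"
    and "\<And>N. N \<ge> 1 \<Longrightarrow> T N = cheb_zeros N \<or> T N = cheb_extrema N"
    and "\<Gamma> = (\<Union>j\<in>{1..s}. z j ` {a j..b j})"
    and "\<And>m n. Z m n = (\<Union>j\<in>{1..s}. mapped_points T (knd j) (z j) (a j) (b j) (k j) m n)"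
  shows "(\<forall>m>1. \<forall>n\<ge>1. (\<forall>j\<in>{1..s}. num_nodes (knd j) m n (k j) \<in> \<int>) \<longrightarrow>
            (\<forall>p :: complex poly. degree p \<le> n \<longrightarrow>
               sup_norm \<Gamma> (poly p) \<le> 1 / cos (pi / (2 * m)) * sup_norm (Z m n) (poly p)))
       \<and> (\<forall>m>1. (\<forall>n\<ge>1. \<forall>j\<in>{1..s}. num_nodes (knd j) m n (k j) \<in> \<int>) \<longrightarrow>
            optimal_admissible_mesh \<Gamma> (Z m))
       \<and> (\<forall>m>1. (\<forall>n\<ge>1. \<forall>j\<in>{1..s}. num_nodes (knd j) m n (k j) \<in> \<int>) \<longrightarrow>
            (\<forall>K. compact K \<and> outer_boundary K \<subseteq> \<Gamma> \<and> \<Gamma> \<subseteq> K \<longrightarrow> admissible_mesh K (Z m)))"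
proof -
  have arc: "admissible_arc (knd j) (z j) (a j) (b j) (k j)" if "j \<in> {1..s}" for j
    unfolding admissible_arc_def using assms(2-4)[OF that] by blast
  have cheb: "chebyshev_points (nat \<lfloor>num_nodes (knd j) m n (k j)\<rfloor>) (T (nat \<lfloor>num_nodes (knd j) m n (k j)\<rfloor>))"
    if "m > 1" "n \<ge> 1" "num_nodes (knd j) m n (k j) \<in> \<int>" "j \<in> {1..s}" for m n j
    unfolding chebyshev_points_def
    by (rule assms(5)[OF num_nodes_ge_1[OF that(3,1,2) assms(3)[OF that(4)]]])
  have fin: "finite (Z m n)"
    if "m > 1" "n \<ge> 1" "\<forall>j\<in>{1..s}. num_nodes (knd j) m n (k j) \<in> \<int>" for m n
    unfolding assms(7) using that by (auto intro!: mapped_points_finite_card(1) cheb)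
  have norming: "sup_norm \<Gamma> (poly p) \<le> 1 / cos (pi / (2 * m)) * sup_norm (Z m n) (poly p)"
    if *: "m > 1" "n \<ge> 1" "\<forall>j\<in>{1..s}. num_nodes (knd j) m n (k j) \<in> \<int>" "degree p \<le> n" for m n p
  proof (rule sup_norm_leI[OF fin[OF *(1-3)]])
    have "pi / (2 * m) < pi / 2"
      using \<open>m > 1\<close> by (simp add: field_simps)
    then show "0 \<le> 1 / cos (pi / (2 * m))"
      using \<open>m > 1\<close> by (intro divide_nonneg_nonneg cos_ge_zero) (auto intro: order_trans[of _ 0])
    fix w assume "w \<in> \<Gamma>"
    then obtain j where j: "j \<in> {1..s}" "w \<in> z j ` {a j..b j}"
      unfolding assms(6) by blast
    have int: "num_nodes (knd j) m n (k j) \<in> \<int>"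
      using * j(1) by blast
    obtain v where "v \<in> mapped_points T (knd j) (z j) (a j) (b j) (k j) m n"
      "norm (poly p w) \<le> 1 / cos (pi / (2 * m)) * norm (poly p v)"
      using arc_norming[where T = T, OF arc[OF j(1)] *(2,1) int cheb[OF *(1,2) int j(1)] *(4) j(2)] by blast
    with j(1) show "\<exists>v\<in>Z m n. norm (poly p w) \<le> 1 / cos (pi / (2 * m)) * norm (poly p v)"
      unfolding assms(7) by blast
  qed
  have "infinite \<Gamma>"
  proof -
    have "1 \<in> {1..s}"
      using assms(1) by simp
    then show ?thesis
      using infinite_arc[OF arc] infinite_super unfolding assms(6) by (metis UN_upper)
  qed
  have mesh: "polynomial_mesh 1 \<Gamma> (Z m)"
    if m: "m > 1" and int: "\<forall>n\<ge>1. \<forall>j\<in>{1..s}. num_nodes (knd j) m n (k j) \<in> \<int>" for m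
    unfolding polynomial_mesh_def
  proof (intro conjI allI impI)
    show "compact \<Gamma>"
      unfolding assms(6)
      by (intro compact_UN compact_continuous_image continuous_on_arc[OF arc]) auto
    show "polynomially_determining \<Gamma>"
      using \<open>infinite \<Gamma>\<close> by (rule polynomially_determining_infinite)
    show "\<exists>c. \<forall>n\<ge>1. \<forall>p. degree p \<le> n \<longrightarrow> sup_norm \<Gamma> (poly p) \<le> c * sup_norm (Z m n) (poly p)"
      using norming[OF m] int by blast
    fix n :: nat assume n: "n \<ge> 1"
    show "finite (Z m n)"
      using fin[OF m n] int n by blast
    show "Z m n \<subseteq> \<Gamma>"
      unfolding assms(6,7) using int n m by (intro UN_mono subset_refl mapped_points_subset arc cheb) auto
  next
    \<comment> \<open>Each arc carries at most N_j + 1 points, and N_j is at most 2 m n k_j for both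
      kinds of maps. The extra point is absorbed by 1 <= n.\<close>
    define C where "C = (\<Sum>j\<in>{1..s}. 2 * m * real (k j) + 1)"
    have "real (card (Z m n)) \<le> C * real n" if n: "n \<ge> 1" for n
    proof -
      have "card (Z m n) \<le> (\<Sum>j\<in>{1..s}. card (mapped_points T (knd j) (z j) (a j) (b j) (k j) m n))"
        unfolding assms(7) by (rule card_UN_le) simp
      also have "real \<dots> \<le> (\<Sum>j\<in>{1..s}. (2 * m * real (k j) + 1) * real n)"
        unfolding of_nat_sum
      proof (rule sum_mono)
        fix j assume j: "j \<in> {1..s}"
        then have i: "num_nodes (knd j) m n (k j) \<in> \<int>"
          using int n by blast
        have "real (card (mapped_points T (knd j) (z j) (a j) (b j) (k j) m n))
            \<le> real (nat \<lfloor>num_nodes (knd j) m n (k j)\<rfloor> + 1)"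
          using mapped_points_finite_card(2)[where T = T, OF cheb[OF m n i j]] by (simp only: of_nat_le_iff)
        also have "\<dots> = num_nodes (knd j) m n (k j) + 1"
          using num_nodes_eq[OF i m] by simp
        also have "\<dots> \<le> 2 * m * real n * real (k j) + real n"
        proof -
          have "0 \<le> m * real n * real (k j)" "1 \<le> real n"
            using m n by auto
          then show ?thesis
            by (cases "knd j") (auto simp: mult.assoc)
        qed
        finally show "real (card (mapped_points T (knd j) (z j) (a j) (b j) (k j) m n))
            \<le> (2 * m * real (k j) + 1) * real n"
          by (simp add: algebra_simps)
      qed
      finally show ?thesis
        unfolding C_def sum_distrib_right by simp
    qed
    then show "(\<lambda>n. real (card (Z m n))) \<in> O(\<lambda>n. real n powr 1)"
      by (intro bigoI[of _ C] eventually_sequentiallyI[of 1]) simp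
  qed
  show ?thesis
  proof (intro conjI allI impI)
    fix m :: real and K
    assume "m > 1" "\<forall>n\<ge>1. \<forall>j\<in>{1..s}. num_nodes (knd j) m n (k j) \<in> \<int>"
      "compact K \<and> outer_boundary K \<subseteq> \<Gamma> \<and> \<Gamma> \<subseteq> K"
    then have "polynomial_mesh 1 K (Z m)"
      using \<open>infinite \<Gamma>\<close> by (intro polynomial_mesh_mono_set[OF mesh]) auto
    then show "admissible_mesh K (Z m)"
      unfolding admissible_mesh_def by auto
  qed (use norming mesh in \<open>auto simp: optimal_admissible_mesh_def\<close>)
qed

end
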